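(* Let $\psi:\mathbb{R}\to\mathbb{C}$ be $2\pi$-periodic and Lipschitz on $[-\pi,\pi]$, i.e. there is $C>0$ with $|\psi(u)-\psi(v)|\le C|u-v|$ for all $u,v\in[-\pi,\pi]$. (i) Let $\varphi(u)=\psi(u)\cosh(u/2)$ and $f(x)=\int_{-\pi}^{\pi}e^{-x\cosh u}\varphi(u)\,du$ for $x>0$. Set $$a_n=\frac{4}{\pi^2}\int_0^\infty \mathrm{Re}\,K_{1/2+in}(x)\,f(x)\,dx,\qquad n\ge 0 .$$ Then for all $x>0$, $$f(x)=\frac{a_0}{2}\,\mathrm{Re}\,J(x,1/2,\pi)+\sum_{n=1}^\infty \cosh(\pi n)\,\mathrm{Re}\,J(x,1/2+in,\pi)\,a_n .$$ (ii) Let $\varphi(u)=\psi(u)\sinh(u/2)$ and $f(x)=\int_{-\pi}^{\pi}e^{-x\cosh u}\varphi(u)\,du$ for $x>0$. Set $$a_n=\frac{4}{\pi^2}\int_0^\infty \mathrm{Im}\,K_{1/2+in}(x)\,f(x)\,dx,\qquad n\ge 0 .$$ Then for all $x>0$, $$f(x)=\sum_{n=1}^\infty \cosh(\pi n)\,\mathrm{Im}\,J(x,1/2+in,\pi)\,a_n .$$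
   Context: $K_\nu(x)=\int_0^\infty e^{-x\cosh t}\cosh(\nu t)\,dt$ for $x>0$ and $\nu\in\mathbb{C}$. For real $\alpha,\tau$ and $x>0$, $\mathrm{Re}\,K_{\alpha+i\tau}(x)=\int_0^\infty e^{-x\cosh t}\cosh(\alpha t)\cos(\tau t)\,dt$ and $\mathrm{Im}\,K_{\alpha+i\tau}(x)=\int_0^\infty e^{-x\cosh t}\sinh(\alpha t)\sin(\tau t)\,dt$. The incomplete modified Bessel function is $J(z,\nu,w)=\int_0^w e^{-z\cosh t}\cosh(\nu t)\,dt$. Hence $\mathrm{Re}\,J(x,\alpha+i\tau,\pi)=\int_0^\pi e^{-x\cosh t}\cosh(\alpha t)\cos(\tau t)\,dt$ and $\mathrm{Im}\,J(x,\alpha+i\tau,\pi)=\int_0^\pi e^{-x\cosh t}\sinh(\alpha t)\sin(\tau t)\,dt$. *)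

theory Defs
  imports "HOL-Analysis.Analysis"
begin

definition BesselK :: "complex \<Rightarrow> real \<Rightarrow> complex" where
  "BesselK \<nu> x = integral {0..} (\<lambda>t::real. complex_of_real (exp (- x * cosh t)) * cosh (\<nu> * complex_of_real t))"

definition incJ :: "real \<Rightarrow> complex \<Rightarrow> real \<Rightarrow> complex" where
  "incJ z \<nu> w = integral {0..w} (\<lambda>t::real. complex_of_real (exp (- z * cosh t)) * cosh (\<nu> * complex_of_real t))"

end

theory Submission
  imports Defs "HOL-Complex_Analysis.Complex_Analysis" "HOL-Real_Asymp.Real_Asymp"
begin

text \<open>
  The partial fraction decomposition
  $4\cosh(t/2)\cosh(u/2)/(\cosh t+\cosh u) = 1/\cosh((t-u)/2) + 1/\cosh((t+u)/2)$ (with a minus sign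
  for the product of hyperbolic sines) and the Fourier transform of $1/\cosh(s/2)$ at $\tau$, which is
  $2\pi/\cosh(\pi\tau)$ by residues, evaluate the Laplace integrals defining the coefficients:
  $\cosh(\pi n)\,a_n$ is $2/\pi$ times the integral of $\psi(u)\cos(nu)$, respectively $\psi(u)\sin(nu)$,
  over $[-\pi,\pi]$. The series therefore is the Parseval pairing on $[0,\pi]$ of the even (odd) part
  of $\psi$ with $e^{-x\cosh t}\cosh(t/2)$ (respectively $\sinh(t/2)$) for the cosine (sine) system.
\<close>

subsection \<open>The Fourier transform of the hyperbolic secant\<close>

text \<open>Neither interchange of limits is controlled pointwise. In the coefficient integral the
  Bessel factor may be unbounded as x tends to 0, so no estimate in x is attempted: the product with
  \<open>f\<close> is one Laplace integral over the (t,u)-plane with exponent -x (cosh t + cosh u).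
  Integrating x out first leaves 1 / (cosh t + cosh u), absolutely integrable against the kernel. In
  the series the \<open>incJ\<close> factors are Fourier coefficients of a continuous function, so
  mean-square approximation of the even or odd part of \<psi> is enough, and pointwise behaviour of
  its own Fourier series never enters. The sine case has an extra obstacle: sine polynomials vanish
  at 0 and pi, so they approximate uniformly only functions that vanish there too. Periodicity and
  the Lipschitz bound supply this for \<psi>(u) - \<psi>(-u). The halved a_0 reflects that the
  constant function has squared norm pi on [0,pi], while the other cosines have pi/2.\<close>

text \<open>A sum of two squares serves two purposes: it locates the zeros of cosh, where both
  squares vanish, and it bounds |cosh z| below by |sinh (Re z)| on vertical lines.\<close>

lemma norm_cosh_squared:
  "(cmod (cosh z))\<^sup>2 = (sinh (Re z))\<^sup>2 + (cos (Im z))\<^sup>2"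
proof -
  have "cosh z = Complex (cosh (Re z) * cos (Im z)) (sinh (Re z) * sin (Im z))"
    by (simp add: cosh_field_def sinh_field_def complex_eq_iff Re_exp Im_exp field_simps)
  then have "(cmod (cosh z))\<^sup>2 = (cosh (Re z))\<^sup>2 * (cos (Im z))\<^sup>2 + (sinh (Re z))\<^sup>2 * (sin (Im z))\<^sup>2"
    by (simp add: cmod_power2 power_mult_distrib)
  also have "\<dots> = (sinh (Re z))\<^sup>2 + (cos (Im z))\<^sup>2"
    by (simp add: cosh_square_eq sin_squared_eq algebra_simps)
  finally show ?thesis .
qed

lemma contour_integral_linepath_translate:
  "contour_integral (linepath (a + c) (b + c)) f = contour_integral (linepath a b) (\<lambda>z. f (z + c))"
  unfolding contour_integral_integral
  by (rule integral_cong) (simp add: linepath_def vector_derivative_linepath_at algebra_simps scaleR_conv_of_real)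

lemma holomorphic_cosh_half: "(\<lambda>z. cosh (z / 2)) holomorphic_on A"
  unfolding cosh_field_def by (intro holomorphic_intros) auto

text \<open>Under the shift by $2\pi i$ the integrand is multiplied by $-e^{-2\pi\tau}$, so the two
  horizontal sides of a rectangle of height $2\pi$ contribute multiples of the same integral.\<close>
lemma sech_integral_rectangle:
  fixes \<tau> R :: real
  defines "F \<equiv> \<lambda>z. exp (\<i> * of_real \<tau> * z) / cosh (z / 2)"
  assumes R: "R > 0"
  shows "norm (of_real (1 + exp (- 2 * pi * \<tau>)) * integral {-R..R} (\<lambda>s. F (of_real s))
            - of_real (4 * pi * exp (- pi * \<tau>))) \<le> 4 * pi * exp (2 * pi * \<bar>\<tau>\<bar>) / sinh (R / 2)"
proof -
  define p where "p = \<i> * of_real pi"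
  \<comment> \<open>A convex strip slightly larger than the rectangle. The zeros of cosh(z/2) are
    the odd multiples of i pi; since pi > 3, the neighbours -i pi and 3 i pi lie outside, so
    \<open>p\<close> is the only pole.\<close>
  define S where "S = {z. Im z > -1 \<and> Im z < 2 * pi + 1}"
  have "S = {z. Im z > -1} \<inter> {z. Im z < 2 * pi + 1}" by (auto simp: S_def)
  then have S: "open S" "convex S"
    by (auto intro: open_halfspace_Im_gt open_halfspace_Im_lt convex_Int convex_halfspace_Im_gt convex_halfspace_Im_lt)
  have pS: "p \<in> S" using pi_gt3 by (simp add: S_def p_def)
  have nz: "cosh (z / 2) \<noteq> 0" if "z \<in> S - {p}" for z
  proof
    assume "cosh (z / 2) = 0"
    then have "(sinh (Re z / 2))\<^sup>2 + (cos (Im z / 2))\<^sup>2 = 0"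
      using norm_cosh_squared[of "z / 2"] by simp
    then have 0: "Re z = 0" "cos (Im z / 2) = 0"
      by (auto simp: sum_power2_eq_zero_iff)
    then obtain k :: int where k: "odd k" "Im z / 2 = of_int k * (pi / 2)"
      unfolding cos_zero_iff_int by blast
    have "-1 < Im z" "Im z < 2 * pi + 1" using that by (auto simp: S_def)
    then have "of_int k * pi > (-1) * pi" "of_int k * pi < 3 * pi" using k pi_gt3 by linarith+
    then have "k > -1" "k < 3" unfolding mult_less_cancel_right_pos[OF pi_gt_zero] by linarith+
    with k(1) have "k = 1" by presburger
    then have "z = p" using 0 k by (simp add: p_def complex_eq_iff)
    then show False using that by simp
  qed
  have holo: "F holomorphic_on S - {p}"
    unfolding F_def by (intro holomorphic_intros holomorphic_cosh_half) (use nz in auto)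
  have res: "residue F p = 2 / \<i> * of_real (exp (- pi * \<tau>))"
  proof -
    have c: "cosh (p / 2) = 0" "sinh (p / 2) = \<i>"
      by (auto simp: p_def cosh_field_def sinh_field_def exp_eq_polar complex_eq_iff Re_exp Im_exp)
    \<comment> \<open>The zero of cosh(z/2) at \<open>p\<close> is simple with derivative i/2. The
      factor 2 pi i of the residue theorem will turn the resulting 2/i into 4 pi.\<close>
    have "residue F p = exp (\<i> * of_real \<tau> * p) / (sinh (p / 2) / 2)"
      unfolding F_def
    proof (rule residue_simple_pole_deriv[where s = S])
      show "connected S" using S(2) by (rule convex_connected)
      show "((\<lambda>z. cosh (z / 2)) has_field_derivative sinh (p / 2) / 2) (at p)"
        by (auto intro!: derivative_eq_intros)
    qed (use S c pS in \<open>auto intro!: holomorphic_intros holomorphic_cosh_half\<close>)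
    also have "\<i> * of_real \<tau> * p = of_real (- pi * \<tau>)"
      by (simp add: p_def complex_eq_iff)
    also have "exp (of_real (- pi * \<tau>)) = complex_of_real (exp (- pi * \<tau>))"
      by (rule exp_of_real)
    finally show ?thesis by (simp add: c)
  qed
  define a1 a2 a3 a4 where a: "a1 = complex_of_real (-R)" "a2 = complex_of_real R"
    "a3 = complex_of_real R + 2 * p" "a4 = complex_of_real (-R) + 2 * p"
  have rp: "rectpath a1 a3 = linepath a1 a2 +++ linepath a2 a3 +++ linepath a3 a4 +++ linepath a4 a1"
    unfolding rectpath_def Let_def by (simp add: a p_def complex_eq_iff Complex_eq algebra_simps)
  have img: "path_image (rectpath a1 a3) \<subseteq> S - {p}"
    using R pi_gt3 by (subst path_image_rectpath) (auto simp: a p_def S_def)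
  have "contour_integral (rectpath a1 a3) F
      = 2 * pi * \<i> * (\<Sum>q\<in>{p}. winding_number (rectpath a1 a3) q * residue F q)"
  proof (rule Residue_theorem)
    show "open S" "connected S" using S convex_connected by auto
    show "\<forall>z. z \<notin> S \<longrightarrow> winding_number (rectpath a1 a3) z = 0"
      using R pi_gt3 by (auto intro!: winding_number_rectpath_outside simp: a p_def S_def in_cbox_complex_iff)
  qed (use holo img in auto)
  also have "(\<Sum>q\<in>{p}. winding_number (rectpath a1 a3) q * residue F q) = residue F p"
    using R by (simp add: winding_number_rectpath a p_def in_box_complex_iff)
  finally have total: "contour_integral (rectpath a1 a3) F = of_real (4 * pi * exp (- pi * \<tau>))"
    by (simp add: res)
  have cont: "continuous_on (S - {p}) F"
    using holo by (rule holomorphic_on_imp_continuous_on)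
  have segs: "closed_segment a1 a2 \<subseteq> S - {p}" "closed_segment a2 a3 \<subseteq> S - {p}"
       "closed_segment a3 a4 \<subseteq> S - {p}" "closed_segment a4 a1 \<subseteq> S - {p}"
    using img by (auto simp: rp path_image_join)
  then have ci: "F contour_integrable_on linepath a1 a2" "F contour_integrable_on linepath a2 a3"
     "F contour_integrable_on linepath a3 a4" "F contour_integrable_on linepath a4 a1"
    by (auto intro!: contour_integrable_continuous_linepath continuous_on_subset[OF cont])
  have sum: "contour_integral (rectpath a1 a3) F = contour_integral (linepath a1 a2) F
     + contour_integral (linepath a2 a3) F + contour_integral (linepath a3 a4) F
     + contour_integral (linepath a4 a1) F"
    unfolding rp using ci by (simp add: contour_integrable_joinI valid_path_join)
  define I where "I = integral {-R..R} (\<lambda>s. F (of_real s))"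
  have I1: "contour_integral (linepath a1 a2) F = I"
    unfolding I_def a(1,2) using R by (subst contour_integral_linepath_Reals_eq) auto
  have shift: "F (z + 2 * p) = - of_real (exp (- 2 * pi * \<tau>)) * F z" for z
  proof -
    have "cosh p = -1" "sinh p = 0"
      by (auto simp: p_def cosh_field_def sinh_field_def exp_minus)
    then have "cosh ((z + 2 * p) / 2) = - cosh (z / 2)"
      by (simp add: add_divide_distrib cosh_add)
    moreover have "exp (\<i> * of_real \<tau> * (z + 2 * p)) = of_real (exp (- 2 * pi * \<tau>)) * exp (\<i> * of_real \<tau> * z)"
      by (simp add: p_def exp_of_real[symmetric] exp_add[symmetric] complex_eq_iff algebra_simps)
    ultimately show ?thesis by (simp add: F_def)
  qed
  \<comment> \<open>The top side runs from right to left. This reversal cancels the minus sign of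
    \<open>shift\<close>, so the horizontal sides add up to the factor 1 + exp(-2 pi \<tau>), which
    is never zero.\<close>
  have "contour_integral (linepath a3 a4) F = - contour_integral (linepath a4 a3) F"
    using contour_integral_reversepath[of "linepath a4 a3" F] by simp
  also have "contour_integral (linepath a4 a3) F = contour_integral (linepath a1 a2) (\<lambda>z. F (z + 2 * p))"
    unfolding a by (rule contour_integral_linepath_translate)
  also have "\<dots> = - of_real (exp (- 2 * pi * \<tau>)) * I"
    unfolding shift using ci(1) I1 by (subst contour_integral_lmul) auto
  finally have I3: "contour_integral (linepath a3 a4) F = of_real (exp (- 2 * pi * \<tau>)) * I" by simp
  define B where "B = exp (2 * pi * \<bar>\<tau>\<bar>) / sinh (R / 2)"
  have B: "B \<ge> 0" using R by (simp add: B_def)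
  have bound: "norm (F z) \<le> B" if "\<bar>Re z\<bar> = R" "0 \<le> Im z" "Im z \<le> 2 * pi" for z
  proof -
    have "- (\<tau> * Im z) \<le> \<bar>\<tau>\<bar> * (2 * pi)"
      by (smt (verit) abs_mult_self_eq abs_ge_minus_self abs_ge_zero mult_left_mono mult_right_mono that mult_minus_left)
    then have "norm (exp (\<i> * of_real \<tau> * z)) \<le> exp (2 * pi * \<bar>\<tau>\<bar>)"
      by (simp add: norm_exp_eq_Re mult_ac)
    \<comment> \<open>Squaring makes the left and right sides alike; dropping the cosine square in
      \<open>norm_cosh_squared\<close> then leaves sinh(R/2) as a lower bound.\<close>
    moreover have "(sinh (R / 2))\<^sup>2 = (sinh (Re (z / 2)))\<^sup>2"
      using that(1) by (auto simp: abs_if split: if_splits)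
    then have "sinh (R / 2) \<le> cmod (cosh (z / 2))"
      by (auto intro: power2_le_imp_le simp: norm_cosh_squared)
    ultimately show ?thesis unfolding F_def B_def norm_divide
      using R by (intro frac_le) auto
  qed
  have "norm (contour_integral (linepath a2 a3) F) \<le> B * norm (a3 - a2)"
    using R by (intro contour_integral_bound_linepath ci B bound)
      (use pi_gt_zero in \<open>auto simp: a p_def closed_segment_same_Re closed_segment_eq_real_ivl split: if_splits\<close>)
  moreover have "norm (contour_integral (linepath a4 a1) F) \<le> B * norm (a1 - a4)"
    using R by (intro contour_integral_bound_linepath ci B bound)
      (use pi_gt_zero in \<open>auto simp: a p_def closed_segment_same_Re closed_segment_eq_real_ivl split: if_splits\<close>)
  moreover have "norm (a3 - a2) = 2 * pi" "norm (a1 - a4) = 2 * pi"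
    by (simp_all add: a p_def norm_mult)
  ultimately have "norm (contour_integral (linepath a2 a3) F) + norm (contour_integral (linepath a4 a1) F) \<le> 4 * pi * B"
    by (simp add: mult.commute)
  moreover have "of_real (1 + exp (- 2 * pi * \<tau>)) * I - of_real (4 * pi * exp (- pi * \<tau>))
     = - (contour_integral (linepath a2 a3) F + contour_integral (linepath a4 a1) F)"
    using sum total unfolding I1 I3 by (simp add: algebra_simps)
  ultimately show ?thesis unfolding I_def[symmetric] B_def
    by (simp only: norm_minus_cancel) (smt (verit) norm_triangle_ineq times_divide_eq_right mult.assoc)
qed

lemma set_integrable_exp_neg:
  fixes c :: real
  assumes "c > 0"
  shows "set_integrable lborel {0..} (\<lambda>x. exp (- x * c))"
proof -
  have "(\<lambda>x. exp (- x * c)) absolutely_integrable_on {0..}"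
    using has_integral_exp_minus_to_infinity[of c 0] assms
    by (intro nonnegative_absolutely_integrable_1) (auto simp: has_integral_iff mult.commute)
  then show ?thesis
    unfolding absolutely_integrable_on_def set_integrable_def
    by (subst integrable_completion[symmetric]) auto
qed

lemma complex_of_real_cosh: "complex_of_real (cosh x) = cosh (of_real x)"
  by (simp add: cosh_field_def exp_of_real[symmetric])

text \<open>Exponential decay: 1 / cosh(s/2) is at most 2 exp(-|s|/2). This function is the common
  majorant for the Fourier integrals here and for the Bessel kernels later.\<close>

lemma integrable_sech_half: "integrable lborel (\<lambda>s::real. 1 / cosh (s / 2))"
proof -
  have 1: "integrable lborel (\<lambda>s::real. indicator {0..} s * exp (- s / 2))"
    using set_integrable_exp_neg[of "1/2"] by (simp add: set_integrable_def)
  then have 2: "integrable lborel (\<lambda>s::real. indicator {0..} (- s) * exp (s / 2))"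
    using lborel_integrable_real_affine_iff[of "-1" "\<lambda>s. indicator {0..} s * exp (- s / 2)" 0] by simp
  show ?thesis
  proof (rule Bochner_Integration.integrable_bound)
    show "integrable lborel (\<lambda>s::real. 2 * (indicator {0..} s * exp (- s / 2) + indicator {0..} (- s) * exp (s / 2)))"
      using 1 2 by (intro integrable_mult_right Bochner_Integration.integrable_add)
    show "AE s in lborel. norm (1 / cosh (s / 2)) \<le> norm (2 * (indicator {0..} s * exp (- s / 2) + indicator {0..} (- s) * exp (s / 2)) :: real)"
    proof (rule AE_I2)
      fix s :: real
      have "1 / cosh (s / 2) \<le> 2 * exp (- \<bar>s\<bar> / 2)"
      proof -
        have "exp (\<bar>s\<bar> / 2) / 2 \<le> cosh (s / 2)"
          by (auto simp: cosh_field_def abs_if field_simps)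
        then have "1 / cosh (s / 2) \<le> 1 / (exp (\<bar>s\<bar> / 2) / 2)"
          by (intro divide_left_mono) auto
        then show ?thesis by (simp add: exp_minus field_simps)
      qed
      also have "\<dots> \<le> 2 * (indicator {0..} s * exp (- s / 2) + indicator {0..} (- s) * exp (s / 2))"
        by (auto simp: indicator_def)
      finally show "norm (1 / cosh (s / 2)) \<le> norm (2 * (indicator {0..} s * exp (- s / 2) + indicator {0..} (- s) * exp (s / 2)) :: real)"
        by (simp add: cosh_real_pos)
    qed
  qed (auto intro!: borel_measurable_continuous_onI continuous_intros)
qed

text \<open>The rectangle estimate has a right-hand side tending to 0 with R, while dominated
  convergence identifies the limit of its left-hand side. Solving for the integral gives 4 pi
  exp(-pi \<tau>) / (1 + exp(-2 pi \<tau>)), the stated hyperbolic secant.\<close>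

lemma has_bochner_integral_fourier_sech_half:
  fixes \<tau> :: real
  shows "has_bochner_integral lborel (\<lambda>s. exp (\<i> * of_real (\<tau> * s)) / of_real (cosh (s / 2))) (of_real (2 * pi / cosh (pi * \<tau>)))"
proof -
  define F where "F = (\<lambda>s::real. exp (\<i> * of_real (\<tau> * s)) / of_real (cosh (s / 2)) :: complex)"
  have F_meas [measurable]: "F \<in> borel_measurable borel"
    unfolding F_def by (intro borel_measurable_continuous_onI continuous_intros) auto
  have norm_F: "norm (F s) = 1 / cosh (s / 2)" for s
    by (simp add: F_def norm_divide)
  have int: "integrable lborel F"
    by (rule Bochner_Integration.integrable_bound[OF integrable_sech_half]) (auto simp: norm_F)
  have conv: "((\<lambda>R. LINT s|lborel. indicator {-R..R} s *\<^sub>R F s) \<longlongrightarrow> integral\<^sup>L lborel F) at_top"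
  proof (rule integral_dominated_convergence_at_top[where w = "\<lambda>s. 1 / cosh (s / 2)"])
    show "AE s in lborel. ((\<lambda>R. indicator {-R..R} s *\<^sub>R F s) \<longlongrightarrow> F s) at_top"
    proof (rule AE_I2)
      fix s :: real
      have "\<forall>\<^sub>F R in at_top. indicator {-R..R} s *\<^sub>R F s = F s"
        using eventually_ge_at_top[of "\<bar>s\<bar>"] by eventually_elim (auto simp: indicator_def)
      then show "((\<lambda>R. indicator {-R..R} s *\<^sub>R F s) \<longlongrightarrow> F s) at_top"
        by (rule tendsto_eventually)
    qed
    show "\<forall>\<^sub>F R in at_top. AE s in lborel. norm (indicator {-R..R} s *\<^sub>R F s) \<le> 1 / cosh (s / 2)"
      by (intro always_eventually allI AE_I2) (auto simp: norm_F indicator_def)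
  qed (auto intro: integrable_sech_half)
  have hk: "(LINT s|lborel. indicator {-R..R} s *\<^sub>R F s) = integral {-R..R} F" for R
    using set_borel_integral_eq_integral(2)[of "{-R..R}" F] int
    by (simp add: set_lebesgue_integral_def set_integrable_def integrable_mult_indicator)
  define L where "L = of_real (1 + exp (- 2 * pi * \<tau>)) * integral\<^sup>L lborel F - of_real (4 * pi * exp (- pi * \<tau>))"
  have lim: "((\<lambda>R. of_real (1 + exp (- 2 * pi * \<tau>)) * integral {-R..R} F - of_real (4 * pi * exp (- pi * \<tau>))) \<longlongrightarrow> L) at_top"
    unfolding L_def by (intro tendsto_intros conv[unfolded hk])
  have "((\<lambda>R. of_real (1 + exp (- 2 * pi * \<tau>)) * integral {-R..R} F - of_real (4 * pi * exp (- pi * \<tau>))) \<longlongrightarrow> 0) at_top"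
  proof (rule Lim_null_comparison)
    show "((\<lambda>R. 4 * pi * exp (2 * pi * \<bar>\<tau>\<bar>) / sinh (R / 2)) \<longlongrightarrow> 0) at_top"
      unfolding sinh_field_def by real_asymp
    have F_eq: "F = (\<lambda>s. exp (\<i> * of_real \<tau> * of_real s) / cosh (of_real s / 2))"
      by (simp add: F_def fun_eq_iff mult.assoc complex_of_real_cosh)
    show "\<forall>\<^sub>F R in at_top. norm (of_real (1 + exp (- 2 * pi * \<tau>)) * integral {-R..R} F - of_real (4 * pi * exp (- pi * \<tau>)))
         \<le> 4 * pi * exp (2 * pi * \<bar>\<tau>\<bar>) / sinh (R / 2)"
    proof (rule eventually_mono[OF eventually_gt_at_top[of 0]])
      fix R :: real
      assume "0 < R"
      then show "norm (of_real (1 + exp (- 2 * pi * \<tau>)) * integral {-R..R} F - of_real (4 * pi * exp (- pi * \<tau>)))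
         \<le> 4 * pi * exp (2 * pi * \<bar>\<tau>\<bar>) / sinh (R / 2)"
        unfolding F_eq by (rule sech_integral_rectangle)
    qed
  qed
  with lim have "L = 0" by (intro tendsto_unique) auto
  then have "of_real (1 + exp (- 2 * pi * \<tau>)) * integral\<^sup>L lborel F = of_real (4 * pi * exp (- pi * \<tau>))"
    by (simp add: L_def)
  moreover have nz: "1 + exp (- 2 * pi * \<tau>) > 0" by (simp add: add_pos_pos)
  ultimately have "integral\<^sup>L lborel F = of_real (4 * pi * exp (- pi * \<tau>) / (1 + exp (- 2 * pi * \<tau>)))"
    unfolding of_real_divide by (subst eq_divide_eq) (simp add: mult.commute del: of_real_add)
  also have "4 * pi * exp (- pi * \<tau>) / (1 + exp (- 2 * pi * \<tau>)) = 2 * pi / cosh (pi * \<tau>)"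
  proof -
    have c: "2 * cosh (pi * \<tau>) = exp (pi * \<tau>) + exp (- (pi * \<tau>))"
      by (simp add: cosh_field_def)
    have eq: "exp (- (pi * \<tau>)) * (2 * cosh (pi * \<tau>)) = 1 + exp (- 2 * pi * \<tau>)"
      unfolding c distrib_left by (simp flip: exp_add)
    show ?thesis unfolding eq[symmetric] by simp
  qed
  finally show ?thesis using int by (simp add: has_bochner_integral_iff F_def)
qed

lemma has_bochner_integral_fourier_sech_half_shift:
  fixes \<tau> u :: real
  shows "has_bochner_integral lborel (\<lambda>t. exp (\<i> * of_real (\<tau> * t)) / of_real (cosh ((t - u) / 2)))
           (exp (\<i> * of_real (\<tau> * u)) * of_real (2 * pi / cosh (pi * \<tau>)))"
proof -
  have "has_bochner_integral lborel (\<lambda>t. exp (\<i> * of_real (\<tau> * (- u + 1 * t))) / of_real (cosh ((- u + 1 * t) / 2)))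
           (of_real (2 * pi / cosh (pi * \<tau>)))"
    using lborel_has_bochner_integral_real_affine_iff[THEN iffD1, OF _ has_bochner_integral_fourier_sech_half, of 1 \<tau> "- u"] by simp
  from has_bochner_integral_mult_right[OF this, of "exp (\<i> * of_real (\<tau> * u))"]
  show ?thesis
    by (simp add: exp_add[symmetric] algebra_simps)
qed

section \<open>Half-line integrals with the kernel 1 / (cosh t + cosh u)\<close>

lemma has_bochner_integral_even_half:
  fixes f :: "real \<Rightarrow> real"
  assumes f: "has_bochner_integral lborel f I" and even: "\<And>t. f (- t) = f t"
  shows "has_bochner_integral lborel (\<lambda>t. indicator {0..} t * f t) (I / 2)"
proof -
  have int: "integrable lborel (\<lambda>t. indicator {0..} t * f t)"
    using f integrable_mult_indicator[of "{0..}" lborel f] by (simp add: has_bochner_integral_iff)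
  then have "has_bochner_integral lborel (\<lambda>t. indicator {0..} (0 + -1 * t) * f (0 + -1 * t))
     ((LINT t|lborel. indicator {0..} t * f t) /\<^sub>R \<bar>-1\<bar>)"
    by (subst lborel_has_bochner_integral_real_affine_iff[symmetric]) (auto simp: has_bochner_integral_iff)
  then have refl: "has_bochner_integral lborel (\<lambda>t. indicator {0..} (- t) * f t) (LINT t|lborel. indicator {0..} t * f t)"
    using even by simp
  have "AE t in lborel. t \<noteq> (0::real)" by (rule AE_lborel_singleton)
  then have "AE t in lborel. f t = indicator {0..} t * f t + indicator {0..} (- t) * f t"
    by eventually_elim (auto simp: indicator_def)
  then have "integral\<^sup>L lborel f = (LINT t|lborel. indicator {0..} t * f t + indicator {0..} (- t) * f t)"
    using f refl int by (intro integral_cong_AE) (auto simp: has_bochner_integral_iff)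
  also have "\<dots> = 2 * (LINT t|lborel. indicator {0..} t * f t)"
    using int refl by (simp add: has_bochner_integral_iff)
  finally show ?thesis using f int by (simp add: has_bochner_integral_iff)
qed

text \<open>The translates by u and -u contribute equally: the cosine is even, and for the sine its
  oddness is compensated by the minus sign in the partial fractions. Halving for the half-line gives
  2 * 2 pi / 4 / 2 = pi/2. The factor in u stays on the left so that nothing is divided by
  sinh(u/2), which vanishes at u = 0.\<close>

lemma sech_kernel:
  fixes \<tau> u :: real
  shows sech_kernel_cos: "cosh (u / 2) * (LINT t|lborel. indicator {0..} t * (cosh (t / 2) * cos (\<tau> * t) / (cosh t + cosh u)))
           = pi * cos (\<tau> * u) / (2 * cosh (pi * \<tau>))"
    and sech_kernel_sin: "sinh (u / 2) * (LINT t|lborel. indicator {0..} t * (sinh (t / 2) * sin (\<tau> * t) / (cosh t + cosh u)))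
           = pi * sin (\<tau> * u) / (2 * cosh (pi * \<tau>))"
proof -
  have sum: "cosh t + cosh u = 2 * (cosh ((t - u) / 2) * cosh ((t + u) / 2))" for t
    using cosh_add[of "(t + u) / 2" "(t - u) / 2"] cosh_diff[of "(t + u) / 2" "(t - u) / 2"]
    by (simp add: field_simps)
  have nz: "cosh ((t - u) / 2) \<noteq> 0" "cosh ((t + u) / 2) \<noteq> 0" for t by simp_all
  have pf: "cosh (u / 2) * cosh (t / 2) / (cosh t + cosh u) = (1 / cosh ((t - u) / 2) + 1 / cosh ((t + u) / 2)) / 4"
           "sinh (u / 2) * sinh (t / 2) / (cosh t + cosh u) = (1 / cosh ((t - u) / 2) - 1 / cosh ((t + u) / 2)) / 4" for t
    unfolding sum using nz[of t]
    by (simp_all add: field_simps) (simp_all add: add_divide_distrib diff_divide_distrib cosh_add cosh_diff)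
  have shift: "has_bochner_integral lborel (\<lambda>t. cos (\<tau> * t) / cosh ((t - v) / 2)) (cos (\<tau> * v) * (2 * pi / cosh (pi * \<tau>)))"
              "has_bochner_integral lborel (\<lambda>t. sin (\<tau> * t) / cosh ((t - v) / 2)) (sin (\<tau> * v) * (2 * pi / cosh (pi * \<tau>)))" for v
    using has_bochner_integral_Re[OF has_bochner_integral_fourier_sech_half_shift[of \<tau> v]]
          has_bochner_integral_Im[OF has_bochner_integral_fourier_sech_half_shift[of \<tau> v]]
    by (simp_all add: Re_exp Im_exp)
  have "has_bochner_integral lborel (\<lambda>t. (cos (\<tau> * t) / cosh ((t - u) / 2) + cos (\<tau> * t) / cosh ((t - (- u)) / 2)) / 4)
     ((cos (\<tau> * u) * (2 * pi / cosh (pi * \<tau>)) + cos (\<tau> * (- u)) * (2 * pi / cosh (pi * \<tau>))) / 4)"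
    by (intro has_bochner_integral_divide_zero has_bochner_integral_add shift)
  also have "(\<lambda>t. (cos (\<tau> * t) / cosh ((t - u) / 2) + cos (\<tau> * t) / cosh ((t - (- u)) / 2)) / 4)
      = (\<lambda>t. cosh (u / 2) * (cosh (t / 2) * cos (\<tau> * t) / (cosh t + cosh u)))" (is "_ = ?f")
  proof
    fix t
    show "(cos (\<tau> * t) / cosh ((t - u) / 2) + cos (\<tau> * t) / cosh ((t - (- u)) / 2)) / 4 = ?f t"
      using arg_cong[OF pf(1)[of t], of "\<lambda>z. z * cos (\<tau> * t)"] by (simp add: field_simps)
  qed
  finally have "has_bochner_integral lborel (\<lambda>t. indicator {0..} t * ?f t)
     ((cos (\<tau> * u) * (2 * pi / cosh (pi * \<tau>)) + cos (\<tau> * (- u)) * (2 * pi / cosh (pi * \<tau>))) / 4 / 2)"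
    by (rule has_bochner_integral_even_half) simp
  then have "(LINT t|lborel. cosh (u / 2) * (indicator {0..} t * (cosh (t / 2) * cos (\<tau> * t) / (cosh t + cosh u))))
     = pi * cos (\<tau> * u) / (2 * cosh (pi * \<tau>))"
    by (subst (asm) has_bochner_integral_iff) (simp add: field_simps)
  then show "cosh (u / 2) * (LINT t|lborel. indicator {0..} t * (cosh (t / 2) * cos (\<tau> * t) / (cosh t + cosh u)))
           = pi * cos (\<tau> * u) / (2 * cosh (pi * \<tau>))" by (simp only: integral_mult_right_zero)
  have "has_bochner_integral lborel (\<lambda>t. (sin (\<tau> * t) / cosh ((t - u) / 2) - sin (\<tau> * t) / cosh ((t - (- u)) / 2)) / 4)
     ((sin (\<tau> * u) * (2 * pi / cosh (pi * \<tau>)) - sin (\<tau> * (- u)) * (2 * pi / cosh (pi * \<tau>))) / 4)"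
    by (intro has_bochner_integral_divide_zero has_bochner_integral_diff shift)
  also have "(\<lambda>t. (sin (\<tau> * t) / cosh ((t - u) / 2) - sin (\<tau> * t) / cosh ((t - (- u)) / 2)) / 4)
      = (\<lambda>t. sinh (u / 2) * (sinh (t / 2) * sin (\<tau> * t) / (cosh t + cosh u)))" (is "_ = ?g")
  proof
    fix t
    show "(sin (\<tau> * t) / cosh ((t - u) / 2) - sin (\<tau> * t) / cosh ((t - (- u)) / 2)) / 4 = ?g t"
      using arg_cong[OF pf(2)[of t], of "\<lambda>z. z * sin (\<tau> * t)"] by (simp add: field_simps)
  qed
  finally have "has_bochner_integral lborel (\<lambda>t. indicator {0..} t * ?g t)
     ((sin (\<tau> * u) * (2 * pi / cosh (pi * \<tau>)) - sin (\<tau> * (- u)) * (2 * pi / cosh (pi * \<tau>))) / 4 / 2)"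
    by (rule has_bochner_integral_even_half) simp
  then have "(LINT t|lborel. sinh (u / 2) * (indicator {0..} t * (sinh (t / 2) * sin (\<tau> * t) / (cosh t + cosh u))))
     = pi * sin (\<tau> * u) / (2 * cosh (pi * \<tau>))"
    by (subst (asm) has_bochner_integral_iff) (simp add: field_simps)
  then show "sinh (u / 2) * (LINT t|lborel. indicator {0..} t * (sinh (t / 2) * sin (\<tau> * t) / (cosh t + cosh u)))
           = pi * sin (\<tau> * u) / (2 * cosh (pi * \<tau>))" by (simp only: integral_mult_right_zero)
qed

subsection \<open>Laplace integrals\<close>

lemma has_bochner_integral_exp_neg:
  fixes c :: real
  assumes "c > 0"
  shows "has_bochner_integral lborel (\<lambda>x. indicator {0<..} x * exp (- x * c)) (1 / c)"
proof -
  have s: "set_integrable lborel {0<..} (\<lambda>x. exp (- x * c))"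
    by (rule set_integrable_subset[OF set_integrable_exp_neg[OF assms]]) auto
  have "((\<lambda>x. exp (- x * c)) has_integral 1 / c) {0..}"
    using has_integral_exp_minus_to_infinity[of c 0] assms by (simp add: mult.commute)
  then have "((\<lambda>x. exp (- x * c)) has_integral 1 / c) {0<..}"
    by (subst (asm) has_integral_spike_set_eq[where T = "{0<..}"]) (auto intro: negligible_subset[of "{0}"])
  then show ?thesis
    using set_borel_integral_eq_integral(2)[OF s] s
    by (simp add: has_bochner_integral_iff set_integrable_def set_lebesgue_integral_def integral_unique)
qed

text \<open>The integral of exp(-x q) over x > 0 is 1/q, so integrability of p/q is exactly absolute
  integrability of the double integral, and Fubini applies. Integrability in x comes out as part of
  the conclusion. The measure \<open>M\<close> is kept general because the plane of pairs (t,u) will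
  be substituted for it.\<close>

lemma has_bochner_integral_laplace:
  fixes p :: "'a \<Rightarrow> complex" and q :: "'a \<Rightarrow> real"
  assumes M: "sigma_finite_measure M"
    and p [measurable]: "p \<in> borel_measurable M" and q [measurable]: "q \<in> borel_measurable M"
    and pos: "\<And>t. t \<in> space M \<Longrightarrow> q t > 0"
    and int: "integrable M (\<lambda>t. p t / of_real (q t))"
  shows "has_bochner_integral lborel (\<lambda>x. indicator {0<..} x *\<^sub>R (\<integral>t. exp (- x * q t) *\<^sub>R p t \<partial>M))
           (\<integral>t. p t / of_real (q t) \<partial>M)"
proof -
  interpret M: sigma_finite_measure M by fact
  interpret P: pair_sigma_finite M lborel ..
  define F where "F t x = (indicator {0<..} x * exp (- x * q t)) *\<^sub>R p t" for t and x :: real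
  have inner: "has_bochner_integral lborel (F t) (p t / of_real (q t))" if "t \<in> space M" for t
    using has_bochner_integral_scaleR_left[OF has_bochner_integral_exp_neg[OF pos[OF that]], of "p t"]
    unfolding F_def by (simp add: scaleR_conv_of_real)
  have F_meas [measurable]: "case_prod F \<in> borel_measurable (M \<Otimes>\<^sub>M lborel)"
    unfolding F_def case_prod_beta by measurable
  have "integrable (M \<Otimes>\<^sub>M lborel) (case_prod F)"
  proof (rule P.Fubini_integrable)
    have "(LINT x|lborel. norm (F t x)) = norm (p t / of_real (q t))" if "t \<in> space M" for t
    proof -
      have "(LINT x|lborel. norm (F t x)) = (LINT x|lborel. indicator {0<..} x * exp (- x * q t)) * norm (p t)"
        by (simp add: F_def)
      then show ?thesis
        using has_bochner_integral_exp_neg[OF pos[OF that]] pos[OF that]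
        by (simp add: has_bochner_integral_iff norm_divide)
    qed
    then show "integrable M (\<lambda>t. LINT x|lborel. norm (case (t, x) of (t, x) \<Rightarrow> F t x))"
      using integrable_norm[OF int] by (simp cong: Bochner_Integration.integrable_cong)
    show "AE t in M. integrable lborel (\<lambda>x. case (t, x) of (t, x) \<Rightarrow> F t x)"
      using inner by (auto simp: has_bochner_integral_iff)
  qed simp
  note P.integrable_snd[OF this] P.integral_snd[OF this] P.integral_fst[OF this]
  moreover have "(\<integral>t. F t x \<partial>M) = indicator {0<..} x *\<^sub>R (\<integral>t. exp (- x * q t) *\<^sub>R p t \<partial>M)" for x
    by (simp add: F_def flip: scaleR_scaleR)
  moreover have "(\<integral>t. (LINT x|lborel. F t x) \<partial>M) = (\<integral>t. p t / of_real (q t) \<partial>M)"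
    using inner by (intro Bochner_Integration.integral_cong) (auto simp: has_bochner_integral_iff)
  ultimately show ?thesis by (simp add: has_bochner_integral_iff)
qed

lemma integrable_integral_product:
  fixes f g :: "real \<Rightarrow> complex"
  assumes f: "integrable lborel f" and g: "integrable lborel g"
  shows integrable_product_function: "integrable (lborel \<Otimes>\<^sub>M lborel) (\<lambda>z. f (fst z) * g (snd z))"
    and integral_product_function:
      "(\<integral>z. f (fst z) * g (snd z) \<partial>(lborel \<Otimes>\<^sub>M lborel)) = integral\<^sup>L lborel f * integral\<^sup>L lborel g"
proof -
  have [measurable]: "f \<in> borel_measurable borel" "g \<in> borel_measurable borel"
    using f g by auto
  show int: "integrable (lborel \<Otimes>\<^sub>M lborel) (\<lambda>z. f (fst z) * g (snd z))"
    using f g by (intro lborel_pair.Fubini_integrable) (auto simp: norm_mult)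
  show "(\<integral>z. f (fst z) * g (snd z) \<partial>(lborel \<Otimes>\<^sub>M lborel)) = integral\<^sup>L lborel f * integral\<^sup>L lborel g"
    using lborel_pair.integral_fst'[OF int] by simp
qed

text \<open>From cosh t = 2 cosh(t/2)^2 - 1 follows cosh t \<ge> cosh(t/2)^2, so a kernel of size
  cosh(t/2) divided by cosh t is dominated by 1 / cosh(t/2). The exponential version reduces to this
  one by exp(-y) \<le> 1/y.\<close>

lemma integrable_exp_cosh:
  fixes P :: "real \<Rightarrow> real"
  assumes [measurable]: "P \<in> borel_measurable borel" and P: "\<And>t. \<bar>P t\<bar> \<le> cosh (t / 2)"
  shows integrable_over_cosh: "integrable lborel (\<lambda>t. P t / cosh t)"
    and integrable_exp_cosh_mult: "x > 0 \<Longrightarrow> integrable lborel (\<lambda>t. exp (- x * cosh t) * P t)"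
proof -
  have [measurable]: "(cosh :: real \<Rightarrow> real) \<in> borel_measurable borel"
    by (intro borel_measurable_continuous_onI continuous_intros)
  have le: "\<bar>P t\<bar> / cosh t \<le> 1 / cosh (t / 2)" for t
  proof -
    have "cosh t = 2 * (cosh (t / 2))\<^sup>2 - 1"
      using cosh_double_cosh[of "t / 2"] by simp
    moreover have "1 \<le> (cosh (t / 2))\<^sup>2"
      using cosh_real_ge_1[of "t / 2"] by (simp add: power2_eq_square mult_ge1_I)
    ultimately have "cosh (t / 2) * cosh (t / 2) \<le> cosh t"
      by (simp add: power2_eq_square)
    then have "\<bar>P t\<bar> * cosh (t / 2) \<le> cosh t"
      by (rule order_trans[OF mult_right_mono[OF P[of t]], rotated]) simp
    then show ?thesis by (simp add: field_simps)
  qed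
  show 1: "integrable lborel (\<lambda>t. P t / cosh t)"
    by (rule Bochner_Integration.integrable_bound[OF integrable_sech_half]) (auto simp: le)
  assume x: "x > 0"
  have "exp (- x * cosh t) \<le> 1 / (x * cosh t)" for t
  proof -
    have "x * cosh t \<le> exp (x * cosh t)"
      using exp_ge_add_one_self[of "x * cosh t"] by linarith
    then show ?thesis using x by (simp add: exp_minus field_simps)
  qed
  then have "\<bar>exp (- x * cosh t) * P t\<bar> \<le> \<bar>1 / x * (P t / cosh t)\<bar>" for t
    using mult_right_mono[of "exp (- x * cosh t)" "1 / (x * cosh t)" "\<bar>P t\<bar>"] x by (simp add: abs_mult)
  then show "integrable lborel (\<lambda>t. exp (- x * cosh t) * P t)"
    by (intro Bochner_Integration.integrable_bound[OF integrable_mult_right[OF 1, of "1 / x"]] AE_I2) auto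
qed

text \<open>For fixed x > 0 the two one-dimensional integrals multiply to a single integral over the
  plane with exponent -x (cosh t + cosh u). For the integrability of the quotient, cosh u is dropped
  from the denominator, which leaves a product of integrable functions of t and of u.\<close>

lemma has_bochner_integral_laplace_product:
  fixes P :: "real \<Rightarrow> real" and \<Phi> :: "real \<Rightarrow> complex"
  assumes [measurable]: "P \<in> borel_measurable borel" and P: "\<And>t. \<bar>P t\<bar> \<le> cosh (t / 2)"
    and \<Phi>: "integrable lborel \<Phi>"
  shows "has_bochner_integral lborel
      (\<lambda>x. indicator {0<..} x *\<^sub>R (of_real (LINT t|lborel. indicator {0..} t * (exp (- x * cosh t) * P t)) *
                 (LINT u|lborel. exp (- x * cosh u) *\<^sub>R \<Phi> u)))
      (LINT u|lborel. of_real (LINT t|lborel. indicator {0..} t * (P t / (cosh t + cosh u))) * \<Phi> u)"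
proof -
  have [measurable]: "(cosh :: real \<Rightarrow> real) \<in> borel_measurable borel"
    by (intro borel_measurable_continuous_onI continuous_intros)
  have [measurable]: "\<Phi> \<in> borel_measurable borel" using \<Phi> by auto
  define P0 where "P0 t = indicator {0..} t * P t" for t :: real
  have [measurable]: "P0 \<in> borel_measurable borel" unfolding P0_def by measurable
  have P0: "\<bar>P0 t\<bar> \<le> cosh (t / 2)" for t
    using P[of t] by (auto simp: P0_def indicator_def intro: cosh_real_nonneg)
  define p where "p z = complex_of_real (P0 (fst z)) * \<Phi> (snd z)" for z
  define q where "q z = cosh (fst z) + cosh (snd z)" for z :: "real \<times> real"
  have q_pos: "q z > 0" for z by (simp add: q_def add_pos_pos)
  have int: "integrable (lborel \<Otimes>\<^sub>M lborel) (\<lambda>z. p z / of_real (q z))"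
  proof (rule Bochner_Integration.integrable_bound)
    show "integrable (lborel \<Otimes>\<^sub>M lborel) (\<lambda>z. of_real (P0 (fst z) / cosh (fst z)) * \<Phi> (snd z))"
      using \<Phi> by (intro integrable_product_function[of "\<lambda>t. of_real (P0 t / cosh t)"] integrable_of_real integrable_over_cosh P0) auto
    show "AE z in lborel \<Otimes>\<^sub>M lborel. norm (p z / of_real (q z)) \<le> norm (of_real (P0 (fst z) / cosh (fst z)) * \<Phi> (snd z))"
    proof (rule AE_I2)
      fix z :: "real \<times> real"
      have "norm (p z) / q z \<le> norm (p z) / cosh (fst z)"
        by (intro divide_left_mono mult_pos_pos q_pos) (auto simp: q_def)
      then show "norm (p z / of_real (q z)) \<le> norm (of_real (P0 (fst z) / cosh (fst z)) * \<Phi> (snd z))"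
        using q_pos[of z] by (simp add: norm_divide norm_mult p_def)
    qed
  qed (unfold p_def q_def, measurable)
  have "sigma_finite_measure (lborel \<Otimes>\<^sub>M lborel :: (real \<times> real) measure)" ..
  from has_bochner_integral_laplace[OF this _ _ q_pos int]
  have main: "has_bochner_integral lborel
      (\<lambda>x. indicator {0<..} x *\<^sub>R (\<integral>z. exp (- x * q z) *\<^sub>R p z \<partial>(lborel \<Otimes>\<^sub>M lborel)))
      (\<integral>z. p z / of_real (q z) \<partial>(lborel \<Otimes>\<^sub>M lborel))"
    unfolding p_def q_def by measurable
  have "(\<integral>z. exp (- x * q z) *\<^sub>R p z \<partial>(lborel \<Otimes>\<^sub>M lborel))
     = of_real (LINT t|lborel. exp (- x * cosh t) * P0 t) * (LINT u|lborel. exp (- x * cosh u) *\<^sub>R \<Phi> u)"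
    if "x > 0" for x
  proof -
    have "integrable lborel (\<lambda>u. exp (- x * cosh u) *\<^sub>R \<Phi> u)"
      by (rule Bochner_Integration.integrable_bound[OF \<Phi>]) (use that in \<open>auto intro!: mult_left_le_one_le\<close>)
    moreover have "integrable lborel (\<lambda>t. complex_of_real (exp (- x * cosh t) * P0 t))"
      by (intro integrable_of_real integrable_exp_cosh_mult P0 that) auto
    ultimately have "(\<integral>z. of_real (exp (- x * cosh (fst z)) * P0 (fst z)) * (exp (- x * cosh (snd z)) *\<^sub>R \<Phi> (snd z)) \<partial>(lborel \<Otimes>\<^sub>M lborel))
        = (LINT t|lborel. of_real (exp (- x * cosh t) * P0 t)) * (LINT u|lborel. exp (- x * cosh u) *\<^sub>R \<Phi> u)"
      by (intro integral_product_function)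
    also have "(\<lambda>z. of_real (exp (- x * cosh (fst z)) * P0 (fst z)) * (exp (- x * cosh (snd z)) *\<^sub>R \<Phi> (snd z)))
        = (\<lambda>z. exp (- x * q z) *\<^sub>R p z)"
      by (simp add: fun_eq_iff p_def q_def scaleR_conv_of_real distrib_left mult_exp_exp[symmetric] mult_ac exp_diff exp_minus divide_inverse)
    finally show ?thesis by (simp only: integral_complex_of_real)
  qed
  then have "(\<lambda>x. indicator {0<..} x *\<^sub>R (\<integral>z. exp (- x * q z) *\<^sub>R p z \<partial>(lborel \<Otimes>\<^sub>M lborel)))
    = (\<lambda>x. indicator {0<..} x *\<^sub>R (of_real (LINT t|lborel. indicator {0..} t * (exp (- x * cosh t) * P t)) *
                 (LINT u|lborel. exp (- x * cosh u) *\<^sub>R \<Phi> u)))"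
    by (auto simp: fun_eq_iff indicator_def P0_def mult_ac)
  moreover have "(\<integral>z. p z / of_real (q z) \<partial>(lborel \<Otimes>\<^sub>M lborel))
     = (LINT u|lborel. of_real (LINT t|lborel. indicator {0..} t * (P t / (cosh t + cosh u))) * \<Phi> u)"
  proof -
    have "(LINT t|lborel. p (t, u) / of_real (q (t, u)))
       = of_real (LINT t|lborel. indicator {0..} t * (P t / (cosh t + cosh u))) * \<Phi> u" for u
    proof -
      have "(\<lambda>t. p (t, u) / of_real (q (t, u))) = (\<lambda>t. of_real (indicator {0..} t * (P t / (cosh t + cosh u))) * \<Phi> u)"
        by (simp add: p_def q_def P0_def fun_eq_iff)
      then show ?thesis by (simp only: integral_mult_left_zero integral_complex_of_real)
    qed
    then show ?thesis
      using lborel_pair.integral_snd[of "\<lambda>t u. p (t, u) / of_real (q (t, u))"] int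
      by (simp only: case_prod_unfold prod.collapse)
  qed
  ultimately show ?thesis using main by simp
qed

subsection \<open>Cosine and sine expansions\<close>

text \<open>Bessel's inequality in disguise: the partial sum $Q$ is the best approximation of $g$, so
  $\int (g-Q)^2$ is small as soon as some combination of the $e_n$ is uniformly close to $g$.\<close>
lemma orthogonal_expansion_sums:
  fixes e :: "nat \<Rightarrow> real \<Rightarrow> real" and g G :: "real \<Rightarrow> real" and c :: "nat \<Rightarrow> real"
  assumes e: "\<And>n. continuous_on {a..b} (e n)"
    and orth: "\<And>m n. integral {a..b} (\<lambda>t. e m t * e n t) = (if m = n then c n else 0)"
    and c: "\<And>n. c n \<noteq> 0"
    and g: "continuous_on {a..b} g" and G: "continuous_on {a..b} G"
    and approx: "\<And>\<epsilon>. \<epsilon> > 0 \<Longrightarrow> \<exists>N \<alpha>. \<forall>t\<in>{a..b}. \<bar>g t - (\<Sum>n<N. \<alpha> n * e n t)\<bar> \<le> \<epsilon>"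
  shows "(\<lambda>n. integral {a..b} (\<lambda>t. g t * e n t) * integral {a..b} (\<lambda>t. G t * e n t) / c n)
           sums integral {a..b} (\<lambda>t. g t * G t)"
proof (cases "a \<le> b")
  case False
  then show ?thesis by simp
next
  case ab: True
  note int [simp] = integrable_continuous_interval
  define gh where "gh n = integral {a..b} (\<lambda>t. g t * e n t) / c n" for n
  define Q where "Q M t = (\<Sum>n<M. gh n * e n t)" for M t
  have Q: "continuous_on {a..b} (Q M)" for M
    unfolding Q_def by (intro continuous_intros e)
  have perp: "integral {a..b} (\<lambda>t. (g t - Q M t) * e n t) = 0" if "n < M" for n M
  proof -
    have "integral {a..b} (\<lambda>t. Q M t * e n t) = (\<Sum>k<M. integral {a..b} (\<lambda>t. gh k * (e k t * e n t)))"
      unfolding Q_def sum_distrib_right mult.assoc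
      by (rule integral_sum) (auto intro!: int continuous_intros e)
    also have "\<dots> = (\<Sum>k<M. if k = n then gh n * c n else 0)"
      by (intro sum.cong) (auto simp: orth)
    also have "\<dots> = integral {a..b} (\<lambda>t. g t * e n t)"
      using that c[of n] by (simp add: gh_def)
    finally show ?thesis
      by (simp add: left_diff_distrib integral_diff int continuous_intros e g Q)
  qed
  have best: "integral {a..b} (\<lambda>t. (g t - Q M t)\<^sup>2) \<le> \<epsilon>\<^sup>2 * (b - a)"
    if P: "\<forall>t\<in>{a..b}. \<bar>g t - (\<Sum>n<N. \<alpha> n * e n t)\<bar> \<le> \<epsilon>" and "N \<le> M" for N M \<alpha> \<epsilon>
  proof -
    \<comment> \<open>The error of the given combination splits into g - Q plus a combination of the
      e_n with n < M. These are orthogonal by \<open>perp\<close>, so by Pythagoras the error of Q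
      is no larger. Padding \<alpha> with zeros makes this work for every M \<ge> N.\<close>
    define \<beta> where "\<beta> n = gh n - (if n < N then \<alpha> n else 0)" for n
    have sumN: "(\<Sum>n<N. \<alpha> n * e n t) = (\<Sum>n<M. (if n < N then \<alpha> n else 0) * e n t)" for t
      using \<open>N \<le> M\<close> by (intro sum.mono_neutral_cong_left) auto
    have split: "g t - (\<Sum>n<N. \<alpha> n * e n t) = (g t - Q M t) + (\<Sum>n<M. \<beta> n * e n t)" for t
      unfolding sumN Q_def \<beta>_def by (simp add: left_diff_distrib sum_subtractf)
    have cross: "integral {a..b} (\<lambda>t. (g t - Q M t) * (\<Sum>n<M. \<beta> n * e n t)) = 0"
    proof -
      have "integral {a..b} (\<lambda>t. (g t - Q M t) * (\<Sum>n<M. \<beta> n * e n t))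
          = (\<Sum>n<M. integral {a..b} (\<lambda>t. \<beta> n * ((g t - Q M t) * e n t)))"
        unfolding sum_distrib_left mult.left_commute[of _ "\<beta> _"]
        by (rule integral_sum) (auto intro!: int continuous_intros e g Q)
      also have "\<dots> = 0" by (intro sum.neutral) (simp add: perp)
      finally show ?thesis .
    qed
    have "integral {a..b} (\<lambda>t. (g t - Q M t)\<^sup>2)
        \<le> integral {a..b} (\<lambda>t. (g t - Q M t)\<^sup>2) + integral {a..b} (\<lambda>t. (\<Sum>n<M. \<beta> n * e n t)\<^sup>2)
           + 2 * integral {a..b} (\<lambda>t. (g t - Q M t) * (\<Sum>n<M. \<beta> n * e n t))"
      unfolding cross by (auto intro!: integral_nonneg int continuous_intros e)
    also have "\<dots> = integral {a..b} (\<lambda>t. (g t - Q M t)\<^sup>2 + (\<Sum>n<M. \<beta> n * e n t)\<^sup>2 + 2 * ((g t - Q M t) * (\<Sum>n<M. \<beta> n * e n t)))"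
      by (simp add: integral_add int continuous_intros e g Q del: integral_mult_right)
         (simp)
    also have "\<dots> = integral {a..b} (\<lambda>t. (g t - (\<Sum>n<N. \<alpha> n * e n t))\<^sup>2)"
      unfolding split by (intro integral_cong) (simp add: power2_sum)
    also have "\<dots> \<le> integral {a..b} (\<lambda>t. \<epsilon>\<^sup>2)"
      using P by (intro integral_le int continuous_intros e g) (auto intro!: abs_le_square_iff[THEN iffD1] order_trans[OF _ abs_ge_self])
    also have "\<dots> = \<epsilon>\<^sup>2 * (b - a)" using ab by simp
    finally show ?thesis .
  qed
  have partial: "(\<Sum>n<M. integral {a..b} (\<lambda>t. g t * e n t) * integral {a..b} (\<lambda>t. G t * e n t) / c n)
      = integral {a..b} (\<lambda>t. Q M t * G t)" for M
  proof -
    have "integral {a..b} (\<lambda>t. Q M t * G t) = (\<Sum>n<M. integral {a..b} (\<lambda>t. gh n * (G t * e n t)))"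
      unfolding Q_def sum_distrib_right by (subst integral_sum[symmetric]) (auto intro!: int continuous_intros e G simp: mult_ac)
    then show ?thesis by (simp add: gh_def)
  qed
  define K where "K = (b - a + integral {a..b} (\<lambda>t. (G t)\<^sup>2)) / 2"
  have K: "K \<ge> 0" unfolding K_def using ab by (auto intro!: integral_nonneg add_nonneg_nonneg int continuous_intros G)
  have bound: "\<bar>integral {a..b} (\<lambda>t. g t * G t) - integral {a..b} (\<lambda>t. Q M t * G t)\<bar> \<le> \<epsilon> * K"
    if P: "\<forall>t\<in>{a..b}. \<bar>g t - (\<Sum>n<N. \<alpha> n * e n t)\<bar> \<le> \<epsilon>" and "N \<le> M" and "\<epsilon> > 0" for N M \<alpha> \<epsilon>
  proof -
    \<comment> \<open>Young's inequality weighted by \<epsilon> takes the place of Cauchy-Schwarz: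
      the mean-square error, of order \<epsilon>^2, is divided by 2 \<epsilon>, and the norm of
      \<open>G\<close> is multiplied by \<epsilon>/2. Together they give \<epsilon> times the fixed
      \<open>K\<close>.\<close>
    have young: "\<bar>x * y\<bar> \<le> inverse (2 * \<epsilon>) * x\<^sup>2 + \<epsilon> / 2 * y\<^sup>2" for x y :: real
    proof -
      have "0 \<le> (\<bar>x\<bar> - \<epsilon> * \<bar>y\<bar>)\<^sup>2" by simp
      also have "\<dots> = x\<^sup>2 + \<epsilon>\<^sup>2 * y\<^sup>2 - 2 * \<epsilon> * \<bar>x * y\<bar>"
        by (simp add: power2_diff power_mult_distrib abs_mult)
      finally show ?thesis using \<open>\<epsilon> > 0\<close> by (simp add: field_simps power2_eq_square)
    qed
    have "integral {a..b} (\<lambda>t. g t * G t) - integral {a..b} (\<lambda>t. Q M t * G t) = integral {a..b} (\<lambda>t. (g t - Q M t) * G t)"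
      by (simp add: left_diff_distrib integral_diff int continuous_intros g G Q)
    moreover have "norm (integral {a..b} (\<lambda>t. (g t - Q M t) * G t))
        \<le> integral {a..b} (\<lambda>t. inverse (2 * \<epsilon>) * (g t - Q M t)\<^sup>2 + \<epsilon> / 2 * (G t)\<^sup>2)"
      using young by (intro integral_norm_bound_integral int continuous_intros g G Q) auto
    moreover have "\<dots> = inverse (2 * \<epsilon>) * integral {a..b} (\<lambda>t. (g t - Q M t)\<^sup>2) + \<epsilon> / 2 * integral {a..b} (\<lambda>t. (G t)\<^sup>2)"
      by (subst integral_add) (auto intro!: int continuous_intros g G Q)
    moreover have "inverse (2 * \<epsilon>) * integral {a..b} (\<lambda>t. (g t - Q M t)\<^sup>2) \<le> inverse (2 * \<epsilon>) * (\<epsilon>\<^sup>2 * (b - a))"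
      using best[OF P \<open>N \<le> M\<close>] \<open>\<epsilon> > 0\<close> by (intro mult_left_mono) auto
    moreover have "inverse (2 * \<epsilon>) * (\<epsilon>\<^sup>2 * (b - a)) + \<epsilon> / 2 * integral {a..b} (\<lambda>t. (G t)\<^sup>2) = \<epsilon> * K"
      using \<open>\<epsilon> > 0\<close> by (simp add: K_def field_simps power2_eq_square)
    ultimately show ?thesis by simp
  qed
  have "(\<lambda>M. integral {a..b} (\<lambda>t. Q M t * G t)) \<longlonglongrightarrow> integral {a..b} (\<lambda>t. g t * G t)"
  proof (rule LIMSEQ_I)
    fix r :: real assume "r > 0"
    \<comment> \<open>The added 1 keeps the quotient meaningful and \<epsilon> * K strictly below r,
      also when \<open>K\<close> is 0.\<close>
    define \<epsilon> where "\<epsilon> = r / (K + 1)"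
    have eps: "\<epsilon> > 0" "\<epsilon> * K < r" using \<open>r > 0\<close> K by (auto simp: \<epsilon>_def field_simps)
    obtain N \<alpha> where P: "\<forall>t\<in>{a..b}. \<bar>g t - (\<Sum>n<N. \<alpha> n * e n t)\<bar> \<le> \<epsilon>" using approx[OF eps(1)] by blast
    show "\<exists>N. \<forall>M\<ge>N. norm (integral {a..b} (\<lambda>t. Q M t * G t) - integral {a..b} (\<lambda>t. g t * G t)) < r"
    proof (intro exI allI impI)
      fix M assume "N \<le> M"
      from bound[OF P this eps(1)] eps(2)
      show "norm (integral {a..b} (\<lambda>t. Q M t * G t) - integral {a..b} (\<lambda>t. g t * G t)) < r"
        by simp
    qed
  qed
  then show ?thesis unfolding sums_def partial .
qed

section \<open>Uniform approximation by cosine and sine polynomials\<close>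

text \<open>The linear span of the sequence \<open>e\<close>, written with initial segments so that
  its members have the shape of the approximants in \<open>orthogonal_expansion_sums\<close>. Sums
  of different lengths are combined by padding coefficients with zeros.\<close>

definition finite_combination :: "(nat \<Rightarrow> real \<Rightarrow> real) \<Rightarrow> (real \<Rightarrow> real) \<Rightarrow> bool" where
  "finite_combination e P \<longleftrightarrow> (\<exists>N \<alpha>. P = (\<lambda>t. \<Sum>n<N. \<alpha> n * e n t))"

lemma finite_combination_basis: "finite_combination e (e n)"
  unfolding finite_combination_def
  by (rule exI[of _ "Suc n"], rule exI[of _ "\<lambda>k. if k = n then 1 else 0"]) (simp add: if_distrib cong: if_cong)

lemma finite_combination_scale: "finite_combination e P \<Longrightarrow> finite_combination e (\<lambda>t. r * P t)"
  unfolding finite_combination_def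
  by (elim exE, rule_tac x = N in exI, rule_tac x = "\<lambda>n. r * \<alpha> n" in exI) (simp add: sum_distrib_left mult.assoc)

lemma finite_combination_add:
  assumes "finite_combination e P" "finite_combination e Q"
  shows "finite_combination e (\<lambda>t. P t + Q t)"
proof -
  obtain N M \<alpha> \<beta> where P: "P = (\<lambda>t. \<Sum>n<N. \<alpha> n * e n t)" and Q: "Q = (\<lambda>t. \<Sum>n<M. \<beta> n * e n t)"
    using assms unfolding finite_combination_def by blast
  define \<gamma> where "\<gamma> n = (if n < N then \<alpha> n else 0) + (if n < M then \<beta> n else 0)" for n
  have "(\<Sum>n<N. \<alpha> n * e n t) = (\<Sum>n<max N M. (if n < N then \<alpha> n else 0) * e n t)" for t
    by (intro sum.mono_neutral_cong_left) auto
  moreover have "(\<Sum>n<M. \<beta> n * e n t) = (\<Sum>n<max N M. (if n < M then \<beta> n else 0) * e n t)" for t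
    by (intro sum.mono_neutral_cong_left) auto
  ultimately have "(\<lambda>t. P t + Q t) = (\<lambda>t. \<Sum>n<max N M. \<gamma> n * e n t)"
    by (simp add: P Q \<gamma>_def sum.distrib distrib_right)
  then show ?thesis unfolding finite_combination_def by blast
qed

lemma finite_combination_sum:
  "(\<And>i. i < k \<Longrightarrow> finite_combination e (P i)) \<Longrightarrow> finite_combination e (\<lambda>t. \<Sum>i<(k::nat). P i t)"
proof (induction k)
  case 0
  then show ?case by (auto simp: finite_combination_def intro!: exI[of _ 0])
next
  case (Suc k)
  then show ?case by (simp add: finite_combination_add)
qed

text \<open>If multiplication by cos maps every basis function into the span, it maps the whole span
  into itself, and powers follow by induction. The starting function is 1 for the cosine system and
  sin for the sine system.\<close>

lemma finite_combination_cos_power: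
  assumes base: "finite_combination e p"
    and step: "\<And>n. finite_combination e (\<lambda>t. cos t * e n t)"
  shows "finite_combination e (\<lambda>t. cos t ^ k * p t)"
proof (induction k)
  case 0
  then show ?case using base by simp
next
  case (Suc k)
  then obtain N \<alpha> where *: "(\<lambda>t. cos t ^ k * p t) = (\<lambda>t. \<Sum>n<N. \<alpha> n * e n t)"
    unfolding finite_combination_def by blast
  have "finite_combination e (\<lambda>t. \<Sum>n<N. \<alpha> n * (cos t * e n t))"
    by (intro finite_combination_sum finite_combination_scale step)
  also have "(\<lambda>t. \<Sum>n<N. \<alpha> n * (cos t * e n t)) = (\<lambda>t. cos t ^ Suc k * p t)"
    using fun_cong[OF *] by (simp add: mult.assoc sum_distrib_left mult.left_commute)
  finally show ?case .
qed

text \<open>The substitution x = cos t identifies [0,pi] with [-1,1], where \<open>g\<close>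
  composed with arccos is continuous and polynomials are dense.\<close>

lemma weierstrass_cos:
  fixes g :: "real \<Rightarrow> real"
  assumes g: "continuous_on {0..pi} g" and "\<epsilon> > 0"
  obtains N :: nat and \<alpha> where "\<And>t. t \<in> {0..pi} \<Longrightarrow> \<bar>g t - (\<Sum>k<N. \<alpha> k * cos t ^ k)\<bar> < \<epsilon>"
proof -
  have "continuous_on {-1..1} (g \<circ> arccos)"
    by (intro continuous_on_compose continuous_on_arccos' continuous_on_subset[OF g])
       (auto simp: arccos_lbound arccos_ubound)
  from Stone_Weierstrass_real_polynomial_function[OF compact_Icc this \<open>\<epsilon> > 0\<close>]
  obtain p where p: "real_polynomial_function p" "\<And>x. x \<in> {-1..1} \<Longrightarrow> \<bar>(g \<circ> arccos) x - p x\<bar> < \<epsilon>"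
    by blast
  then obtain \<alpha> n where pa: "p = (\<lambda>x. \<Sum>i\<le>n. \<alpha> i * x ^ i)"
    unfolding real_polynomial_function_iff_sum by blast
  show ?thesis
  proof (rule that[of \<alpha> "Suc n"])
    fix t assume "t \<in> {0..pi}"
    then show "\<bar>g t - (\<Sum>k<Suc n. \<alpha> k * cos t ^ k)\<bar> < \<epsilon>"
      using p(2)[of "cos t"] by (simp add: pa lessThan_Suc_atMost arccos_cos)
  qed
qed

text \<open>Since 2 cos t cos(nt) = cos((n+1)t) + cos((n-1)t), the span is stable under
  multiplication by cos. It therefore contains all powers of cos, and the Weierstrass approximants
  belong to it.\<close>

lemma cos_approx:
  fixes g :: "real \<Rightarrow> real"
  assumes g: "continuous_on {0..pi} g" and "\<epsilon> > 0"
  shows "\<exists>N \<alpha>. \<forall>t\<in>{0..pi}. \<bar>g t - (\<Sum>n<N. \<alpha> n * cos (real n * t))\<bar> \<le> \<epsilon>"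
proof -
  let ?e = "\<lambda>n t. cos (real n * t)"
  obtain N \<alpha> where N: "\<And>t. t \<in> {0..pi} \<Longrightarrow> \<bar>g t - (\<Sum>k<N. \<alpha> k * cos t ^ k)\<bar> < \<epsilon>"
    using weierstrass_cos[OF assms] by blast
  have "finite_combination ?e (\<lambda>t. cos t * ?e n t)" for n
  proof (cases n)
    case 0
    then show ?thesis using finite_combination_basis[of ?e 1] by simp
  next
    case (Suc m)
    have "finite_combination ?e (\<lambda>t. (1/2) * ?e (Suc n) t + (1/2) * ?e m t)"
      by (intro finite_combination_add finite_combination_scale finite_combination_basis)
    also have "(\<lambda>t. (1/2) * ?e (Suc n) t + (1/2) * ?e m t) = (\<lambda>t. cos t * ?e n t)"
    proof
      fix t
      have "real (Suc n) * t = real n * t + t" "real m * t = real n * t - t"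
        by (simp_all add: Suc algebra_simps)
      then show "(1/2) * ?e (Suc n) t + (1/2) * ?e m t = cos t * ?e n t"
        by (simp only: cos_add cos_diff) (simp add: algebra_simps)
    qed
    finally show ?thesis .
  qed
  moreover have "finite_combination ?e (\<lambda>t. 1)" using finite_combination_basis[of ?e 0] by simp
  ultimately have "finite_combination ?e (\<lambda>t. cos t ^ k * 1)" for k
    by (intro finite_combination_cos_power)
  then have "finite_combination ?e (\<lambda>t. \<Sum>k<N. \<alpha> k * cos t ^ k)"
    by (intro finite_combination_sum finite_combination_scale) simp
  then show ?thesis unfolding finite_combination_def using N by (metis less_imp_le)
qed

text \<open>A function vanishing at the endpoints at least linearly is $\sin$ times the continuous function
  $g/(\sin+\delta)$, up to an error proportional to $\delta$.\<close>
lemma sin_approx: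
  fixes g :: "real \<Rightarrow> real"
  assumes g: "continuous_on {0..pi} g" and "\<epsilon> > 0"
    and lip: "\<And>t. t \<in> {0..pi} \<Longrightarrow> \<bar>g t\<bar> \<le> C * sin t"
  shows "\<exists>N \<alpha>. \<forall>t\<in>{0..pi}. \<bar>g t - (\<Sum>n<N. \<alpha> n * sin (real (Suc n) * t))\<bar> \<le> \<epsilon>"
proof -
  let ?e = "\<lambda>n t. sin (real (Suc n) * t)"
  \<comment> \<open>Chosen so that the regularisation error, at most |C| \<delta>, takes no more
    than half of \<epsilon>; the other half goes to the polynomial approximation. The added 1 covers
    C = 0.\<close>
  define \<delta> where "\<delta> = \<epsilon> / (2 * (\<bar>C\<bar> + 1))"
  have \<delta>: "\<delta> > 0" "\<bar>C\<bar> * \<delta> \<le> \<epsilon> / 2" using \<open>\<epsilon> > 0\<close> by (auto simp: \<delta>_def field_simps)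
  have pos: "0 \<le> sin t" "0 < sin t + \<delta>" if "t \<in> {0..pi}" for t
    using that sin_ge_zero[of t] \<delta>(1) by auto
  have "continuous_on {0..pi} (\<lambda>t. g t / (sin t + \<delta>))"
    using pos by (intro continuous_intros g) force
  then obtain N \<alpha> where N: "\<And>t. t \<in> {0..pi} \<Longrightarrow> \<bar>g t / (sin t + \<delta>) - (\<Sum>k<N. \<alpha> k * cos t ^ k)\<bar> < \<epsilon> / 2"
    by (rule weierstrass_cos[OF _ half_gt_zero[OF \<open>\<epsilon> > 0\<close>]]) blast
  \<comment> \<open>Index n stands for frequency n + 1. At n = 0 the lower neighbour in the product
    formula has frequency 0 and vanishes, so only the double-angle term remains.\<close>
  have "finite_combination ?e (\<lambda>t. cos t * ?e n t)" for n
  proof (cases n)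
    case 0
    have "finite_combination ?e (\<lambda>t. (1/2) * ?e 1 t)"
      by (intro finite_combination_scale finite_combination_basis)
    also have "(\<lambda>t. (1/2) * ?e 1 t) = (\<lambda>t. cos t * ?e n t)"
      by (rule ext) (simp add: 0 sin_double)
    finally show ?thesis .
  next
    case (Suc m)
    have "finite_combination ?e (\<lambda>t. (1/2) * ?e (Suc n) t + (1/2) * ?e m t)"
      by (intro finite_combination_add finite_combination_scale finite_combination_basis)
    also have "(\<lambda>t. (1/2) * ?e (Suc n) t + (1/2) * ?e m t) = (\<lambda>t. cos t * ?e n t)"
    proof
      fix t
      have "real (Suc (Suc n)) * t = real (Suc n) * t + t" "real (Suc m) * t = real (Suc n) * t - t"
        by (simp_all add: Suc algebra_simps)
      then show "(1/2) * ?e (Suc n) t + (1/2) * ?e m t = cos t * ?e n t"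
        by (simp only: sin_add sin_diff) (simp add: algebra_simps)
    qed
    finally show ?thesis .
  qed
  moreover have "finite_combination ?e sin" using finite_combination_basis[of ?e 0] by simp
  ultimately have "finite_combination ?e (\<lambda>t. cos t ^ k * sin t)" for k
    by (intro finite_combination_cos_power)
  then have "finite_combination ?e (\<lambda>t. \<Sum>k<N. \<alpha> k * (cos t ^ k * sin t))"
    by (intro finite_combination_sum finite_combination_scale)
  then obtain M \<beta> where M: "(\<lambda>t. \<Sum>k<N. \<alpha> k * (cos t ^ k * sin t)) = (\<lambda>t. \<Sum>n<M. \<beta> n * ?e n t)"
    unfolding finite_combination_def by blast
  have "\<bar>g t - (\<Sum>n<M. \<beta> n * ?e n t)\<bar> \<le> \<epsilon>" if t: "t \<in> {0..pi}" for t
  proof -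
    define S where "S = (\<Sum>k<N. \<alpha> k * cos t ^ k)"
    have "(\<Sum>n<M. \<beta> n * ?e n t) = sin t * S"
      unfolding fun_cong[OF M, symmetric] S_def by (simp add: sum_distrib_left mult_ac)
    \<comment> \<open>The first summand is the Weierstrass error damped by sin t \<le> 1; the second
      is the cost of replacing sin t by sin t + \<delta> in the denominator.\<close>
    moreover have "g t - sin t * S = sin t * (g t / (sin t + \<delta>) - S) + \<delta> * g t / (sin t + \<delta>)"
    proof -
      define y where "y = g t / (sin t + \<delta>)"
      have "g t = y * (sin t + \<delta>)" using pos[OF t] by (simp add: y_def)
      moreover have "\<delta> * g t / (sin t + \<delta>) = \<delta> * y" by (simp add: y_def)
      ultimately show ?thesis unfolding y_def[symmetric] by (simp add: algebra_simps)
    qed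
    moreover have "\<bar>sin t * (g t / (sin t + \<delta>) - S)\<bar> \<le> 1 * (\<epsilon> / 2)"
      unfolding abs_mult using N[OF t] by (intro mult_mono) (auto simp: S_def)
    moreover have "\<bar>\<delta> * g t / (sin t + \<delta>)\<bar> \<le> \<epsilon> / 2"
    proof -
      have "\<bar>\<delta> * g t\<bar> \<le> \<delta> * (C * sin t)" using lip[OF t] \<delta>(1) by (simp add: abs_mult)
      also have "\<dots> \<le> \<delta> * (\<bar>C\<bar> * (sin t + \<delta>))"
        using pos[OF t] \<delta>(1) by (intro mult_left_mono mult_mono) auto
      also have "\<dots> \<le> \<epsilon> / 2 * (sin t + \<delta>)"
        using mult_right_mono[OF \<delta>(2), of "sin t + \<delta>"] pos[OF t] by (simp add: mult_ac)
      finally show ?thesis using pos[OF t] by (simp add: abs_divide divide_le_eq)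
    qed
    ultimately show ?thesis by linarith
  qed
  then show ?thesis by blast
qed

section \<open>Orthogonality relations on [0,pi]\<close>

text \<open>The frequency is an integer, not a natural number, because the product formulas produce
  differences m - n of either sign. Off zero the antiderivative vanishes at both ends.\<close>

lemma integral_cos_nat: "integral {0..pi} (\<lambda>t. cos (real_of_int k * t)) = (if k = 0 then pi else 0)"
proof (cases "k = 0")
  case False
  have "((\<lambda>t. cos (real_of_int k * t)) has_integral (sin (of_int k * pi) / of_int k - sin (of_int k * 0) / of_int k)) {0..pi}"
    using False by (intro fundamental_theorem_of_calculus)
      (auto intro!: derivative_eq_intros simp: has_real_derivative_iff_has_vector_derivative[symmetric])
  then show ?thesis using False by (simp add: integral_unique sin_times_pi_eq_0)
qed simp

lemma cos_orthogonal:
  "integral {0..pi} (\<lambda>t. cos (real m * t) * cos (real n * t)) = (if m = n then if n = 0 then pi else pi / 2 else 0)"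
proof -
  have "integral {0..pi} (\<lambda>t. cos (real m * t) * cos (real n * t))
     = integral {0..pi} (\<lambda>t. (cos (real_of_int (int m - int n) * t) + cos (real_of_int (int m + int n) * t)) / 2)"
    by (intro integral_cong) (simp add: cos_times_cos algebra_simps)
  also have "\<dots> = (integral {0..pi} (\<lambda>t. cos (real_of_int (int m - int n) * t)) + integral {0..pi} (\<lambda>t. cos (real_of_int (int m + int n) * t))) / 2"
    by (subst integral_divide, subst integral_add) (auto intro!: integrable_continuous_interval continuous_intros)
  finally show ?thesis unfolding integral_cos_nat by auto
qed

text \<open>Starting the system at frequency 1 makes the sum frequency m + n + 2 nonzero, so only m
  = n contributes and the squared norm is pi/2 throughout.\<close>

lemma sin_orthogonal:
  "integral {0..pi} (\<lambda>t. sin (real (Suc m) * t) * sin (real (Suc n) * t)) = (if m = n then pi / 2 else 0)"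
proof -
  have "integral {0..pi} (\<lambda>t. sin (real (Suc m) * t) * sin (real (Suc n) * t))
     = integral {0..pi} (\<lambda>t. (cos (real_of_int (int m - int n) * t) - cos (real_of_int (int m + int n + 2) * t)) / 2)"
    by (intro integral_cong) (simp add: sin_times_sin algebra_simps)
  also have "\<dots> = (integral {0..pi} (\<lambda>t. cos (real_of_int (int m - int n) * t)) - integral {0..pi} (\<lambda>t. cos (real_of_int (int m + int n + 2) * t))) / 2"
    by (subst integral_divide, subst integral_diff) (auto intro!: integrable_continuous_interval continuous_intros)
  finally show ?thesis unfolding integral_cos_nat by auto
qed

subsection \<open>Bessel coefficients\<close>

lemma Re_Im_integral:
  fixes f :: "'a::euclidean_space \<Rightarrow> complex"
  assumes "f integrable_on S"
  shows Re_integral: "Re (integral S f) = integral S (\<lambda>x. Re (f x))"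
    and Im_integral: "Im (integral S f) = integral S (\<lambda>x. Im (f x))"
  using integral_linear[OF assms bounded_linear_Re] integral_linear[OF assms bounded_linear_Im]
  by (simp_all add: o_def)

lemma integral_fold:
  fixes F :: "real \<Rightarrow> 'a::euclidean_space"
  assumes a: "a \<ge> 0" and F: "continuous_on {-a..a} F"
  shows "integral {-a..a} F = integral {0..a} (\<lambda>u. F u + F (- u))"
proof -
  have refl: "continuous_on {0..a} (\<lambda>u. F (- u))"
    using a by (intro continuous_on_compose2[OF F]) (auto intro!: continuous_intros)
  have pos: "continuous_on {0..a} F"
    using a by (intro continuous_on_subset[OF F]) auto
  have "integral {-a..a} F = integral {-a..0} F + integral {0..a} F"
    using a by (intro Henstock_Kurzweil_Integration.integral_combine[symmetric] integrable_continuous_interval F) auto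
  also have "integral {-a..0} F = integral {0..a} (\<lambda>u. F (- u))"
    using Henstock_Kurzweil_Integration.integral_reflect_real[of "a" "0" "\<lambda>u. F (- u)"] by simp
  finally show ?thesis
    using refl pos by (simp add: Henstock_Kurzweil_Integration.integral_add integrable_continuous_interval add.commute)
qed

text \<open>The real expansion is applied to the real and imaginary parts of \<open>g\<close>.
  Approximability is required of these two functions only, because the sine system does not
  approximate every continuous function uniformly.\<close>

lemma orthogonal_expansion_sums_complex:
  fixes e :: "nat \<Rightarrow> real \<Rightarrow> real" and g :: "real \<Rightarrow> complex" and G :: "real \<Rightarrow> real" and c :: "nat \<Rightarrow> real"
  assumes e: "\<And>n. continuous_on {a..b} (e n)"
    and orth: "\<And>m n. integral {a..b} (\<lambda>t. e m t * e n t) = (if m = n then c n else 0)"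
    and c: "\<And>n. c n \<noteq> 0"
    and g: "continuous_on {a..b} g" and G: "continuous_on {a..b} G"
    and approx: "\<And>\<epsilon> h. \<epsilon> > 0 \<Longrightarrow> h = Re \<circ> g \<or> h = Im \<circ> g
        \<Longrightarrow> \<exists>N \<alpha>. \<forall>t\<in>{a..b}. \<bar>h t - (\<Sum>n<N. \<alpha> n * e n t)\<bar> \<le> \<epsilon>"
  shows "(\<lambda>n. integral {a..b} (\<lambda>t. g t * of_real (e n t)) * of_real (integral {a..b} (\<lambda>t. G t * e n t) / c n))
           sums integral {a..b} (\<lambda>t. g t * of_real (G t))"
proof -
  have int: "(\<lambda>t. g t * of_real (h t)) integrable_on {a..b}" if "continuous_on {a..b} h" for h
    by (intro integrable_continuous_interval continuous_intros g that)
  show ?thesis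
    unfolding sums_complex_iff
    using orthogonal_expansion_sums[OF e orth c _ G, of "Re \<circ> g"]
          orthogonal_expansion_sums[OF e orth c _ G, of "Im \<circ> g"] approx
    by (simp add: Re_integral Im_integral int e G g o_def continuous_intros)
qed

lemma cosh_half_plus_imaginary:
  fixes \<tau> t :: real
  shows "Re (cosh ((1/2 + \<i> * of_real \<tau>) * of_real t)) = cosh (t / 2) * cos (\<tau> * t)"
    and "Im (cosh ((1/2 + \<i> * of_real \<tau>) * of_real t)) = sinh (t / 2) * sin (\<tau> * t)"
  by (simp_all add: cosh_field_def sinh_field_def Re_exp Im_exp field_simps)

lemma Re_of_real_mult: "Re (of_real r * z) = r * Re z"
  and Im_of_real_mult: "Im (of_real r * z) = r * Im z"
  by simp_all

lemma Re_Im_incJ: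
  fixes \<tau> x w :: real
  shows Re_incJ: "Re (incJ x (1/2 + \<i> * of_real \<tau>) w) = integral {0..w} (\<lambda>t. exp (- x * cosh t) * cosh (t / 2) * cos (\<tau> * t))"
    and Im_incJ: "Im (incJ x (1/2 + \<i> * of_real \<tau>) w) = integral {0..w} (\<lambda>t. exp (- x * cosh t) * sinh (t / 2) * sin (\<tau> * t))"
proof -
  have "(\<lambda>t. of_real (exp (- x * cosh t)) * cosh ((1/2 + \<i> * of_real \<tau>) * of_real t)) integrable_on {0..w}"
    by (intro integrable_continuous_interval continuous_intros)
  then show "Re (incJ x (1/2 + \<i> * of_real \<tau>) w) = integral {0..w} (\<lambda>t. exp (- x * cosh t) * cosh (t / 2) * cos (\<tau> * t))"
    "Im (incJ x (1/2 + \<i> * of_real \<tau>) w) = integral {0..w} (\<lambda>t. exp (- x * cosh t) * sinh (t / 2) * sin (\<tau> * t))"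
    unfolding incJ_def by (simp_all only: Re_integral Im_integral Re_of_real_mult Im_of_real_mult cosh_half_plus_imaginary mult.assoc)
qed

lemma kernel_bounds:
  fixes \<tau> t :: real
  shows "\<bar>cosh (t / 2) * cos (\<tau> * t)\<bar> \<le> cosh (t / 2)" "\<bar>sinh (t / 2) * sin (\<tau> * t)\<bar> \<le> cosh (t / 2)"
proof -
  have "\<bar>cosh (t / 2)\<bar> * \<bar>cos (\<tau> * t)\<bar> \<le> cosh (t / 2) * 1"
    by (intro mult_mono) auto
  then show "\<bar>cosh (t / 2) * cos (\<tau> * t)\<bar> \<le> cosh (t / 2)" by (simp add: abs_mult)
  have "\<bar>sinh (t / 2)\<bar> * \<bar>sin (\<tau> * t)\<bar> \<le> cosh (t / 2) * 1"
    by (intro mult_mono) (auto simp: abs_le_iff sinh_field_def cosh_field_def)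
  then show "\<bar>sinh (t / 2) * sin (\<tau> * t)\<bar> \<le> cosh (t / 2)" by (simp add: abs_mult)
qed

lemma kernel_measurable:
  fixes \<tau> :: real
  shows "(\<lambda>t. cosh (t / 2) * cos (\<tau> * t)) \<in> borel_measurable borel"
        "(\<lambda>t. sinh (t / 2) * sin (\<tau> * t)) \<in> borel_measurable borel"
  by (auto intro!: borel_measurable_continuous_onI continuous_intros)

text \<open>The gauge integral in \<open>BesselK\<close> becomes a Lebesgue integral over the whole
  line with an indicator, the form needed for Fubini. Domination by
  \<open>integrable_exp_cosh_mult\<close> justifies both this and taking real and imaginary parts
  inside.\<close>

lemma Re_Im_BesselK:
  fixes \<tau> x :: real
  assumes x: "x > 0"
  shows Re_BesselK: "Re (BesselK (1/2 + \<i> * of_real \<tau>) x)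
            = (LINT t|lborel. indicator {0..} t * (exp (- x * cosh t) * (cosh (t / 2) * cos (\<tau> * t))))"
    and Im_BesselK: "Im (BesselK (1/2 + \<i> * of_real \<tau>) x)
            = (LINT t|lborel. indicator {0..} t * (exp (- x * cosh t) * (sinh (t / 2) * sin (\<tau> * t))))"
proof -
  let ?f = "\<lambda>t. of_real (exp (- x * cosh t)) * cosh ((1/2 + \<i> * of_real \<tau>) * of_real t) :: complex"
  have "?f t = of_real (exp (- x * cosh t) * (cosh (t / 2) * cos (\<tau> * t)))
      + \<i> * of_real (exp (- x * cosh t) * (sinh (t / 2) * sin (\<tau> * t)))" for t
    using cosh_half_plus_imaginary[of \<tau> t] by (simp add: complex_eq_iff)
  moreover have "integrable lborel (\<lambda>t. of_real (exp (- x * cosh t) * (cosh (t / 2) * cos (\<tau> * t)))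
      + \<i> * of_real (exp (- x * cosh t) * (sinh (t / 2) * sin (\<tau> * t))))"
    by (intro Bochner_Integration.integrable_add integrable_mult_right integrable_of_real integrable_exp_cosh_mult kernel_bounds kernel_measurable x)
  ultimately have "integrable lborel ?f" by simp
  then have set: "set_integrable lborel {0..} ?f"
    unfolding set_integrable_def by (intro integrable_mult_indicator) auto
  have K: "BesselK (1/2 + \<i> * of_real \<tau>) x = (LINT t|lborel. indicator {0..} t *\<^sub>R ?f t)"
    using set_borel_integral_eq_integral(2)[OF set] by (simp add: BesselK_def set_lebesgue_integral_def)
  show "Re (BesselK (1/2 + \<i> * of_real \<tau>) x)
            = (LINT t|lborel. indicator {0..} t * (exp (- x * cosh t) * (cosh (t / 2) * cos (\<tau> * t))))"
    "Im (BesselK (1/2 + \<i> * of_real \<tau>) x)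
            = (LINT t|lborel. indicator {0..} t * (exp (- x * cosh t) * (sinh (t / 2) * sin (\<tau> * t))))"
    unfolding K using set
    by (simp_all only: set_integrable_def integral_Re[symmetric] integral_Im[symmetric] complex_scaleR
         Re_of_real_mult Im_of_real_mult cosh_half_plus_imaginary scaleR_complex.sel)
qed

text \<open>One computation for both parts of the theorem: \<open>P\<close> is the Bessel kernel in
  t, \<open>w\<close> the hyperbolic weight multiplying \<psi>, and \<open>k\<close> the closed form
  that \<open>sech_kernel\<close> provides for \<open>w\<close> times the remaining
  t-integral.\<close>

lemma bessel_coefficient:
  fixes \<psi> :: "real \<Rightarrow> complex" and P K w k :: "real \<Rightarrow> real"
  assumes P: "P \<in> borel_measurable borel" "\<And>t. \<bar>P t\<bar> \<le> cosh (t / 2)"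
    and \<psi>: "continuous_on {-a..a} \<psi>" and w: "continuous_on {-a..a} w"
    and K: "\<And>x. x > 0 \<Longrightarrow> K x = (LINT t|lborel. indicator {0..} t * (exp (- x * cosh t) * P t))"
    and k_cont: "continuous_on {-a..a} k"
    and k: "\<And>u. w u * (LINT t|lborel. indicator {0..} t * (P t / (cosh t + cosh u))) = k u"
  shows "integral {0<..} (\<lambda>x. of_real (K x) * integral {-a..a} (\<lambda>u. of_real (exp (- x * cosh u)) * (\<psi> u * of_real (w u))))
       = integral {-a..a} (\<lambda>u. \<psi> u * of_real (k u))"
proof -
  \<comment> \<open>Extension by zero moves the interval integral to the whole line, where the
    product lemma is stated.\<close>
  define \<Phi> where "\<Phi> u = indicator {-a..a} u *\<^sub>R (\<psi> u * of_real (w u))" for u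
  have \<Phi>: "integrable lborel \<Phi>"
    unfolding \<Phi>_def by (intro borel_integrable_compact continuous_intros \<psi> w) auto
  have f: "integral {-a..a} (\<lambda>u. of_real (exp (- x * cosh u)) * (\<psi> u * of_real (w u)))
      = (LINT u|lborel. exp (- x * cosh u) *\<^sub>R \<Phi> u)" for x
  proof -
    have "set_integrable lborel {-a..a} (\<lambda>u. of_real (exp (- x * cosh u)) * (\<psi> u * of_real (w u)))"
      unfolding set_integrable_def by (intro borel_integrable_compact continuous_intros \<psi> w) auto
    from set_borel_integral_eq_integral(2)[OF this] show ?thesis
      by (simp add: set_lebesgue_integral_def \<Phi>_def scaleR_conv_of_real mult_ac)
  qed
  note main = has_bochner_integral_laplace_product[OF P \<Phi>]
  have eq: "(\<lambda>x. indicator {0<..} x *\<^sub>R (of_real (LINT t|lborel. indicator {0..} t * (exp (- x * cosh t) * P t)) *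
                 (LINT u|lborel. exp (- x * cosh u) *\<^sub>R \<Phi> u)))
     = (\<lambda>x. indicator {0<..} x *\<^sub>R (of_real (K x) * integral {-a..a} (\<lambda>u. of_real (exp (- x * cosh u)) * (\<psi> u * of_real (w u)))))"
    unfolding f by (rule ext) (auto simp: indicator_def K)
  have "set_integrable lborel {0<..} (\<lambda>x. of_real (K x) * integral {-a..a} (\<lambda>u. of_real (exp (- x * cosh u)) * (\<psi> u * of_real (w u))))"
    using main unfolding eq has_bochner_integral_iff set_integrable_def by blast
  from set_borel_integral_eq_integral(2)[OF this]
  have "integral {0<..} (\<lambda>x. of_real (K x) * integral {-a..a} (\<lambda>u. of_real (exp (- x * cosh u)) * (\<psi> u * of_real (w u))))
      = (LINT u|lborel. of_real (LINT t|lborel. indicator {0..} t * (P t / (cosh t + cosh u))) * \<Phi> u)"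
    using main unfolding eq has_bochner_integral_iff set_lebesgue_integral_def by simp
  also have "(\<lambda>u. of_real (LINT t|lborel. indicator {0..} t * (P t / (cosh t + cosh u))) * \<Phi> u)
      = (\<lambda>u. indicator {-a..a} u *\<^sub>R (\<psi> u * of_real (k u)))"
    by (simp add: fun_eq_iff \<Phi>_def k[symmetric] scaleR_conv_of_real mult_ac)
  finally have I: "integral {0<..} (\<lambda>x. of_real (K x) * integral {-a..a} (\<lambda>u. of_real (exp (- x * cosh u)) * (\<psi> u * of_real (w u))))
      = (LINT u:{-a..a}|lborel. \<psi> u * of_real (k u))"
    unfolding set_lebesgue_integral_def .
  have "set_integrable lborel {-a..a} (\<lambda>u. \<psi> u * of_real (k u))"
    unfolding set_integrable_def by (intro borel_integrable_compact continuous_intros \<psi> k_cont) auto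
  from set_borel_integral_eq_integral(2)[OF this] show ?thesis
    unfolding I .
qed

text \<open>By concavity, sin lies above its chord from 0 to pi/2 (Jordan's inequality), and the
  reflection of t to pi - t covers the other half. This converts linear vanishing at both endpoints
  into the multiple of sin that \<open>sin_approx\<close> asks for.\<close>

lemma min_le_sin:
  fixes t :: real
  assumes "t \<in> {0..pi}"
  shows "min t (pi - t) \<le> pi / 2 * sin t"
proof -
  have conc: "concave_on {0..pi} sin"
  proof (rule f''_le0_imp_concave)
    show "(sin has_real_derivative cos x) (at x)" for x :: real by (rule DERIV_sin)
    show "(cos has_real_derivative - sin x) (at x)" for x :: real by (rule DERIV_cos)
    show "- sin x \<le> 0" if "x \<in> {0..pi}" for x :: real using that sin_ge_zero[of x] by auto
  qed auto
  have *: "s \<le> pi / 2 * sin s" if "0 \<le> s" "s \<le> pi / 2" for s :: real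
  proof -
    define l where "l = 2 * s / pi"
    have l: "0 \<le> l" "l \<le> 1" "s = l * (pi / 2)" using that by (auto simp: l_def field_simps)
    have s_eq: "(1 - l) *\<^sub>R 0 + l *\<^sub>R (pi / 2) = s" using l(3) by simp
    have "(1 - l) * sin 0 + l * sin (pi / 2) \<le> sin s"
      unfolding s_eq[symmetric] using l by (intro concave_onD[OF conc]) auto
    then have "l \<le> sin s" by simp
    then have "pi / 2 * l \<le> pi / 2 * sin s" by (intro mult_left_mono) auto
    moreover have "s = pi / 2 * l" using l(3) by (simp only: mult.commute)
    ultimately show ?thesis by (rule ord_eq_le_trans[rotated])
  qed
  show ?thesis
  proof (cases "t \<le> pi / 2")
    case True
    then show ?thesis using *[of t] assms by (simp add: min_le_iff_disj)
  next
    case False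
    then have "pi - t \<le> pi / 2 * sin (pi - t)" using assms by (intro *) auto
    then have "pi - t \<le> pi / 2 * sin t" by simp
    then show ?thesis by (rule min.coboundedI2)
  qed
qed

theorem theorem4:
  fixes \<psi> :: "real \<Rightarrow> complex"
  assumes periodic: "\<forall>u. \<psi> (u + 2 * pi) = \<psi> u"
    and lipschitz: "\<exists>C>0. \<forall>u\<in>{-pi..pi}. \<forall>v\<in>{-pi..pi}. cmod (\<psi> u - \<psi> v) \<le> C * \<bar>u - v\<bar>"
  shows
    "(let \<phi> = (\<lambda>u. \<psi> u * complex_of_real (cosh (u / 2)));
          f = (\<lambda>x::real. integral {-pi..pi} (\<lambda>u. complex_of_real (exp (- x * cosh u)) * \<phi> u));
          a = (\<lambda>n::nat. complex_of_real (4 / pi\<^sup>2) *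
                 integral {0<..} (\<lambda>x. complex_of_real (Re (BesselK (1/2 + \<i> * of_nat n) x)) * f x))
      in \<forall>x>0. (\<lambda>n::nat. if n = 0 then a 0 / 2 * complex_of_real (Re (incJ x (1/2) pi))
                        else complex_of_real (cosh (pi * real n)) *
                             complex_of_real (Re (incJ x (1/2 + \<i> * of_nat n) pi)) * a n)
               sums f x)
   \<and>
    (let \<phi> = (\<lambda>u. \<psi> u * complex_of_real (sinh (u / 2)));
          f = (\<lambda>x::real. integral {-pi..pi} (\<lambda>u. complex_of_real (exp (- x * cosh u)) * \<phi> u));
          a = (\<lambda>n::nat. complex_of_real (4 / pi\<^sup>2) *
                 integral {0<..} (\<lambda>x. complex_of_real (Im (BesselK (1/2 + \<i> * of_nat n) x)) * f x))
      in \<forall>x>0. (\<lambda>n::nat. if n = 0 then 0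
                        else complex_of_real (cosh (pi * real n)) *
                             complex_of_real (Im (incJ x (1/2 + \<i> * of_nat n) pi)) * a n)
               sums f x)"
proof -
  from lipschitz obtain C where C: "C > 0"
    and lip: "\<And>u v. u \<in> {-pi..pi} \<Longrightarrow> v \<in> {-pi..pi} \<Longrightarrow> cmod (\<psi> u - \<psi> v) \<le> C * \<bar>u - v\<bar>"
    by blast
  have "C-lipschitz_on {-pi..pi} \<psi>"
    using C lip by (intro lipschitz_onI) (auto simp: dist_norm)
  then have \<psi>: "continuous_on {-pi..pi} \<psi>" by (rule lipschitz_on_continuous_on)
  have \<psi>_pos: "continuous_on {0..pi} \<psi>"
    by (rule continuous_on_subset[OF \<psi>]) auto
  have \<psi>_neg: "continuous_on {0..pi} (\<lambda>u. \<psi> (- u))"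
    by (rule continuous_on_compose2[OF \<psi>]) (auto intro!: continuous_intros)
  \<comment> \<open>Twice the even part of \<psi>, and next to it twice the odd part. Folding
    [-pi,pi] onto [0,pi] leaves \<open>g\<close> against even kernels and \<open>h\<close> against
    odd ones.\<close>
  define g where "g u = \<psi> u + \<psi> (- u)" for u
  define h where "h u = \<psi> u - \<psi> (- u)" for u
  have g: "continuous_on {0..pi} g" and h: "continuous_on {0..pi} h"
    unfolding g_def h_def by (intro continuous_intros \<psi>_pos \<psi>_neg)+
  have fold_even: "integral {-pi..pi} (\<lambda>u. \<psi> u * of_real (k u)) = integral {0..pi} (\<lambda>u. g u * of_real (k u))"
    if "continuous_on {-pi..pi} k" "\<And>u. k (- u) = k u" for k
    using that integral_fold[of pi "\<lambda>u. \<psi> u * of_real (k u)"]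
    by (simp add: g_def distrib_right \<psi> continuous_on_mult continuous_on_of_real)
  have fold_odd: "integral {-pi..pi} (\<lambda>u. \<psi> u * of_real (k u)) = integral {0..pi} (\<lambda>u. h u * of_real (k u))"
    if "continuous_on {-pi..pi} k" "\<And>u. k (- u) = - k u" for k
    using that integral_fold[of pi "\<lambda>u. \<psi> u * of_real (k u)"]
    by (simp add: h_def left_diff_distrib \<psi> continuous_on_mult continuous_on_of_real)

  have coeff_cos: "integral {0<..} (\<lambda>x. of_real (Re (BesselK (1/2 + \<i> * of_nat n) x)) *
       integral {-pi..pi} (\<lambda>u. of_real (exp (- x * cosh u)) * (\<psi> u * of_real (cosh (u / 2)))))
     = integral {0..pi} (\<lambda>u. g u * of_real (cos (real n * u))) * of_real (pi / (2 * cosh (pi * real n)))" (is "?l = _") for n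
  proof -
    have "?l = integral {-pi..pi} (\<lambda>u. \<psi> u * of_real (pi * cos (real n * u) / (2 * cosh (pi * real n))))"
      by (rule bessel_coefficient[OF kernel_measurable(1) kernel_bounds(1) \<psi>])
         (use sech_kernel_cos[of _ "real n"] Re_BesselK[of _ "real n"] in \<open>auto intro!: continuous_intros\<close>)
    also have "\<dots> = integral {0..pi} (\<lambda>u. g u * of_real (pi * cos (real n * u) / (2 * cosh (pi * real n))))"
      by (intro fold_even continuous_intros) auto
    also have "\<dots> = integral {0..pi} (\<lambda>u. g u * of_real (cos (real n * u)) * of_real (pi / (2 * cosh (pi * real n))))"
      by (simp add: mult_ac)
    finally show ?thesis by (simp only: integral_mult_left)
  qed
  have coeff_sin: "integral {0<..} (\<lambda>x. of_real (Im (BesselK (1/2 + \<i> * of_nat n) x)) *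
       integral {-pi..pi} (\<lambda>u. of_real (exp (- x * cosh u)) * (\<psi> u * of_real (sinh (u / 2)))))
     = integral {0..pi} (\<lambda>u. h u * of_real (sin (real n * u))) * of_real (pi / (2 * cosh (pi * real n)))" (is "?l = _") for n
  proof -
    have "?l = integral {-pi..pi} (\<lambda>u. \<psi> u * of_real (pi * sin (real n * u) / (2 * cosh (pi * real n))))"
      by (rule bessel_coefficient[OF kernel_measurable(2) kernel_bounds(2) \<psi>])
         (use sech_kernel_sin[of _ "real n"] Im_BesselK[of _ "real n"] in \<open>auto intro!: continuous_intros\<close>)
    also have "\<dots> = integral {0..pi} (\<lambda>u. h u * of_real (pi * sin (real n * u) / (2 * cosh (pi * real n))))"
      by (intro fold_odd continuous_intros) auto
    also have "\<dots> = integral {0..pi} (\<lambda>u. h u * of_real (sin (real n * u)) * of_real (pi / (2 * cosh (pi * real n))))"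
      by (simp add: mult_ac)
    finally show ?thesis by (simp only: integral_mult_left)
  qed

  \<comment> \<open>The same folding turns \<open>f\<close> itself into a pairing on [0,pi], which
    is the value of the orthogonal expansion below; its second factor has the integrals
    \<open>incJ\<close> as coefficients.\<close>
  have f_cos: "integral {-pi..pi} (\<lambda>u. of_real (exp (- x * cosh u)) * (\<psi> u * of_real (cosh (u / 2))))
     = integral {0..pi} (\<lambda>u. g u * of_real (exp (- x * cosh u) * cosh (u / 2)))" for x
    using fold_even[of "\<lambda>u. exp (- x * cosh u) * cosh (u / 2)"] by (simp add: mult_ac continuous_intros)
  have f_sin: "integral {-pi..pi} (\<lambda>u. of_real (exp (- x * cosh u)) * (\<psi> u * of_real (sinh (u / 2))))
     = integral {0..pi} (\<lambda>u. h u * of_real (exp (- x * cosh u) * sinh (u / 2)))" for x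
    using fold_odd[of "\<lambda>u. exp (- x * cosh u) * sinh (u / 2)"] by (simp add: mult_ac continuous_intros)

  have sums_cos: "(\<lambda>n. integral {0..pi} (\<lambda>t. g t * of_real (cos (real n * t))) *
        of_real (integral {0..pi} (\<lambda>t. exp (- x * cosh t) * cosh (t / 2) * cos (real n * t)) / (if n = 0 then pi else pi / 2)))
      sums integral {0..pi} (\<lambda>u. g u * of_real (exp (- x * cosh u) * cosh (u / 2)))" for x
  proof (rule orthogonal_expansion_sums_complex)
    fix \<epsilon> :: real and k assume "\<epsilon> > 0" and "k = Re \<circ> g \<or> k = Im \<circ> g"
    then have "continuous_on {0..pi} k"
      using g by (auto simp: o_def intro!: continuous_intros)
    then show "\<exists>N \<alpha>. \<forall>t\<in>{0..pi}. \<bar>k t - (\<Sum>n<N. \<alpha> n * cos (real n * t))\<bar> \<le> \<epsilon>"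
      using \<open>\<epsilon> > 0\<close> by (rule cos_approx)
  qed (use cos_orthogonal g in \<open>auto intro!: continuous_intros\<close>)

  have h_bound: "cmod (h t) \<le> pi * C * sin t" if t: "t \<in> {0..pi}" for t
  proof -
    have "\<psi> pi = \<psi> (- pi)" using periodic[rule_format, of "- pi"] by simp
    \<comment> \<open>Periodicity enters here: \<psi>(pi) and \<psi>(-pi) agree, so they can be
      inserted freely, and each difference spans a distance pi - t. Near 0 the points t and -t, at
      distance 2t, are compared directly.\<close>
    then have "h t = (\<psi> t - \<psi> pi) - (\<psi> (- t) - \<psi> (- pi))" by (simp add: h_def)
    then have "cmod (h t) \<le> cmod (\<psi> t - \<psi> pi) + cmod (\<psi> (- t) - \<psi> (- pi))"
      by (simp only: norm_triangle_ineq4)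
    also have "\<dots> \<le> 2 * C * (pi - t)"
      using t lip[of t pi] lip[of "- t" "- pi"] by simp
    finally have 1: "cmod (h t) \<le> 2 * C * (pi - t)" .
    have 2: "cmod (h t) \<le> 2 * C * t"
      using t lip[of t "- t"] by (simp add: h_def)
    have "cmod (h t) \<le> 2 * C * min t (pi - t)"
      using 1 2 by (simp add: min_def)
    also have "\<dots> \<le> 2 * C * (pi / 2 * sin t)"
      using C min_le_sin[OF t] by (intro mult_left_mono) auto
    finally show ?thesis by (simp add: mult_ac)
  qed
  have sums_sin: "(\<lambda>n. integral {0..pi} (\<lambda>t. h t * of_real (sin (real (Suc n) * t))) *
        of_real (integral {0..pi} (\<lambda>t. exp (- x * cosh t) * sinh (t / 2) * sin (real (Suc n) * t)) / (pi / 2)))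
      sums integral {0..pi} (\<lambda>u. h u * of_real (exp (- x * cosh u) * sinh (u / 2)))" for x
  proof (rule orthogonal_expansion_sums_complex)
    fix \<epsilon> :: real and k assume "\<epsilon> > 0" and k: "k = Re \<circ> h \<or> k = Im \<circ> h"
    have "continuous_on {0..pi} k"
      using h k by (auto simp: o_def intro!: continuous_intros)
    moreover have "\<bar>k t\<bar> \<le> pi * C * sin t" if "t \<in> {0..pi}" for t
      using k h_bound[OF that] abs_Re_le_cmod[of "h t"] abs_Im_le_cmod[of "h t"] by auto
    ultimately show "\<exists>N \<alpha>. \<forall>t\<in>{0..pi}. \<bar>k t - (\<Sum>n<N. \<alpha> n * sin (real (Suc n) * t))\<bar> \<le> \<epsilon>"
      using \<open>\<epsilon> > 0\<close> by (intro sin_approx)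
  qed (use sin_orthogonal h in \<open>auto intro!: continuous_intros\<close>)

  have Re_J: "Re (incJ x (1/2 + \<i> * of_nat n) pi) = integral {0..pi} (\<lambda>t. exp (- x * cosh t) * cosh (t / 2) * cos (real n * t))" for x n
    using Re_incJ[of x "real n" pi] by simp
  have Re_J0: "Re (incJ x (1/2) pi) = integral {0..pi} (\<lambda>t. exp (- x * cosh t) * cosh (t / 2) * cos (real 0 * t))" for x
    using Re_incJ[of x "0" pi] by simp
  have Im_J: "Im (incJ x (1/2 + \<i> * of_nat n) pi) = integral {0..pi} (\<lambda>t. exp (- x * cosh t) * sinh (t / 2) * sin (real n * t))" for x n
    using Im_incJ[of x "real n" pi] by simp

  \<comment> \<open>Here c is cosh(pi n). It cancels against the secant in the coefficient, and
    4/pi^2 times pi/2 leaves 2/pi, the reciprocal of the squared norm.\<close>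
  have term_eq: "of_real c * of_real J * (of_real (4 / pi\<^sup>2) * (A * of_real (pi / (2 * c)))) = A * of_real (J / (pi / 2))"
    if "c \<noteq> 0" for c J and A :: complex
    using that by (simp add: field_simps power2_eq_square)
  show ?thesis
    unfolding Let_def coeff_cos coeff_sin
    unfolding f_cos f_sin Re_J Re_J0 Im_J
  proof (intro conjI allI impI)
    fix x :: real assume "x > 0"
    have "(if n = 0 then of_real (4 / pi\<^sup>2) * (integral {0..pi} (\<lambda>u. g u * of_real (cos (real 0 * u))) * of_real (pi / (2 * cosh (pi * real 0)))) / 2 *
            of_real (integral {0..pi} (\<lambda>t. exp (- x * cosh t) * cosh (t / 2) * cos (real 0 * t)))
          else of_real (cosh (pi * real n)) * of_real (integral {0..pi} (\<lambda>t. exp (- x * cosh t) * cosh (t / 2) * cos (real n * t))) *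
            (of_real (4 / pi\<^sup>2) * (integral {0..pi} (\<lambda>u. g u * of_real (cos (real n * u))) * of_real (pi / (2 * cosh (pi * real n))))))
        = integral {0..pi} (\<lambda>t. g t * of_real (cos (real n * t))) *
        of_real (integral {0..pi} (\<lambda>t. exp (- x * cosh t) * cosh (t / 2) * cos (real n * t)) / (if n = 0 then pi else pi / 2))" for n
    proof (cases "n = 0")
      case True
      \<comment> \<open>At n = 0 the hyperbolic cosine is 1, and halving a_0 turns 2/pi into 1/pi,
        matching the squared norm pi.\<close>
      then show ?thesis by (simp add: field_simps power2_eq_square)
    next
      case False
      then show ?thesis by (simp only: if_False) (rule term_eq, simp)
    qed
    then show "(\<lambda>n. if n = 0 then of_real (4 / pi\<^sup>2) * (integral {0..pi} (\<lambda>u. g u * of_real (cos (real 0 * u))) * of_real (pi / (2 * cosh (pi * real 0)))) / 2 *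
            of_real (integral {0..pi} (\<lambda>t. exp (- x * cosh t) * cosh (t / 2) * cos (real 0 * t)))
          else of_real (cosh (pi * real n)) * of_real (integral {0..pi} (\<lambda>t. exp (- x * cosh t) * cosh (t / 2) * cos (real n * t))) *
            (of_real (4 / pi\<^sup>2) * (integral {0..pi} (\<lambda>u. g u * of_real (cos (real n * u))) * of_real (pi / (2 * cosh (pi * real n))))))
        sums integral {0..pi} (\<lambda>u. g u * of_real (exp (- x * cosh u) * cosh (u / 2)))"
      using sums_cos[of x] by (simp only:)
  next
    fix x :: real assume "x > 0"
    let ?T = "\<lambda>n. if n = 0 then 0 else of_real (cosh (pi * real n)) *
            of_real (integral {0..pi} (\<lambda>t. exp (- x * cosh t) * sinh (t / 2) * sin (real n * t))) *
            (of_real (4 / pi\<^sup>2) * (integral {0..pi} (\<lambda>u. h u * of_real (sin (real n * u))) * of_real (pi / (2 * cosh (pi * real n)))))"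
    have "?T (Suc n) = integral {0..pi} (\<lambda>t. h t * of_real (sin (real (Suc n) * t))) *
        of_real (integral {0..pi} (\<lambda>t. exp (- x * cosh t) * sinh (t / 2) * sin (real (Suc n) * t)) / (pi / 2))" for n
      by (simp only: if_False nat.distinct) (rule term_eq, simp)
    then have "(\<lambda>n. ?T (Suc n)) sums integral {0..pi} (\<lambda>u. h u * of_real (exp (- x * cosh u) * sinh (u / 2)))"
      using sums_sin[of x] by (simp only:)
    \<comment> \<open>The sine expansion is indexed from frequency 1; since the term at index 0 is
      zero, undoing the shift does not change the sum.\<close>
    then show "?T sums integral {0..pi} (\<lambda>u. h u * of_real (exp (- x * cosh u) * sinh (u / 2)))"
      by (subst (asm) sums_Suc_iff) simp
  qed
qed

end
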